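(* Let $\gamma>0$ and let $(u^k,y^k,p^k)\in L^2(\Omega)\times H^1_0(\Omega)\times H^1_0(\Omega)$ be given. Then the active set step is equivalent to the semismooth Newton step; that is, a triple $(u^{k+1},y^{k+1},p^{k+1})\in L^2(\Omega)\times H^1_0(\Omega)\times H^1_0(\Omega)$ satisfies the Newton system $$\begin{pmatrix} -\mathrm{Id} & A & 0 \\ 0 & \mathrm{Id} & A^* \\ 0 & A & -D_NH_\gamma(p^k) \end{pmatrix} \begin{pmatrix} u^{k+1}-u^k \\ {y^{k+1}-y^k} \\ {p^{k+1}-p^k} \end{pmatrix} = - \begin{pmatrix} Ay^k-u^k \\ {A^*p^k+y^k-z} \\ {Ay^k-H_\gamma(p^k)} \end{pmatrix}$$ if and only if there exists $\lambda^{k+1}\in L^2(\Omega)$ such that $(u^{k+1},y^{k+1},p^{k+1},\lambda^{k+1})$ satisfies the active set system $$Ay^{k+1}-u^{k+1}=0,\qquad A^*p^{k+1}+y^{k+1}-z=0,\qquad -p^{k+1}+\gamma u^{k+1}+\alpha\lambda^{k+1}=0,$$ $$\Big(1-\sum_{i=1}^d\mathbb{1}_{Q_i^k}\Big)\lambda^{k+1}+\Big(1-\sum_{i=1}^{d-1}\mathbb{1}_{Q_{i,i+1}^k}\Big)u^{k+1}=\sum_{i=1}^d\mathbb{1}_{Q_i^k}u_i+\frac12\sum_{i=1}^{d-1}\mathbb{1}_{Q_{i,i+1}^k}(u_i+u_{i+1}).$$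
   Context: Setting: $\Omega\subset\mathbb{R}^n$ is a bounded domain, $z\in L^2(\Omega)$, $\alpha>0$, and $u_1<u_2<\dots<u_d$ are real numbers, $d\ge2$. $A:H^1_0(\Omega)\to H^{-1}(\Omega)$ is a second-order linear differential operator (e.g. $A=-\Delta$) with formal adjoint $A^*$, such that $Ay=u$ in $\Omega$, $y=0$ on $\partial\Omega$ has a unique (weak) solution for each $u\in L^2(\Omega)$; equations involving $A$, $A^*$ are understood in the weak sense with homogeneous Dirichlet conditions. Define subsets of $\mathbb{R}$, for $\gamma>0$: $Q_1^\gamma=\{q: q<\frac\alpha2((1+2\frac\gamma\alpha)u_1+u_2)\}$; $Q_i^\gamma=\{q:\frac\alpha2(u_{i-1}+(1+2\frac\gamma\alpha)u_i)<q<\frac\alpha2((1+2\frac\gamma\alpha)u_i+u_{i+1})\}$ for $1<i<d$; $Q_d^\gamma=\{q: q>\frac\alpha2(u_{d-1}+(1+2\frac\gamma\alpha)u_d)\}$; $Q_{i,i+1}^\gamma=\{q:\frac\alpha2((1+2\frac\gamma\alpha)u_i+u_{i+1})\le q\le\frac\alpha2(u_i+(1+2\frac\gamma\alpha)u_{i+1})\}$ for $1\le i<d$. The operator $H_\gamma$ is the superposition operator $[H_\gamma(p)](x)=u_i$ if $p(x)\in Q_i^\gamma$ ($1\le i\le d$), and $[H_\gamma(p)](x)=\frac1\gamma\big(p(x)-\frac\alpha2(u_i+u_{i+1})\big)$ if $p(x)\in Q_{i,i+1}^\gamma$ ($1\le i<d$). Its Newton derivative is $[D_NH_\gamma(p)h](x)=\frac1\gamma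 h(x)$ if $p(x)\in Q_{i,i+1}^\gamma$ for some $1\le i<d$, and $0$ otherwise. For the given $p^k$: $Q_i^k:=\{x\in\Omega:p^k(x)\in Q_i^\gamma\}$ for $1\le i\le d$ and $Q_{i,i+1}^k:=\{x\in\Omega:p^k(x)\in Q_{i,i+1}^\gamma\}$ for $1\le i<d$. $\mathbb{1}_C$ denotes the characteristic function of a set $C$. *)

theory Defs
  imports "HOL-Analysis.Analysis"
begin

definition bounded_domain :: "(real^'n) set \<Rightarrow> bool" where
  "bounded_domain \<Omega> \<longleftrightarrow> open \<Omega> \<and> connected \<Omega> \<and> \<Omega> \<noteq> {} \<and> bounded \<Omega>"

text \<open>Functions on \<open>\<Omega>\<close> are represented by total functions of which only the values on \<open>\<Omega>\<close>
  matter. Elements of \<open>L\<^sup>2\<close> and of Sobolev spaces are represented by functions rather than by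
  classes modulo null sets, so their equality is equality almost everywhere.\<close>

definition ae_eq :: "(real^'n) set \<Rightarrow> (real^'n \<Rightarrow> real) \<Rightarrow> (real^'n \<Rightarrow> real) \<Rightarrow> bool" where
  "ae_eq \<Omega> f g \<longleftrightarrow> (AE x in lebesgue_on \<Omega>. f x = g x)"

definition L2 :: "(real^'n) set \<Rightarrow> (real^'n \<Rightarrow> real) set" where
  "L2 \<Omega> = {f \<in> borel_measurable (lebesgue_on \<Omega>). integrable (lebesgue_on \<Omega>) (\<lambda>x. (f x)\<^sup>2)}"

definition pderiv_at :: "'n \<Rightarrow> (real^'n \<Rightarrow> real) \<Rightarrow> real^'n \<Rightarrow> real" where
  "pderiv_at i f x = frechet_derivative f (at x) (axis i 1)"

text \<open>The iterated partial derivatives of \<open>f\<close>; the head of the list is differentiated first.\<close>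

fun iter_pderiv :: "'n list \<Rightarrow> (real^'n \<Rightarrow> real) \<Rightarrow> real^'n \<Rightarrow> real" where
  "iter_pderiv [] f = f"
| "iter_pderiv (i # is) f = iter_pderiv is (pderiv_at i f)"

definition smooth :: "(real^'n \<Rightarrow> real) \<Rightarrow> bool" where
  "smooth f \<longleftrightarrow> (\<forall>is x. iter_pderiv is f differentiable (at x))"

definition test_functions :: "(real^'n) set \<Rightarrow> (real^'n \<Rightarrow> real) set" where
  "test_functions \<Omega> = {\<phi>. smooth \<phi> \<and> compact (closure {x. \<phi> x \<noteq> 0}) \<and> closure {x. \<phi> x \<noteq> 0} \<subseteq> \<Omega>}"

definition has_weak_gradient ::
    "(real^'n) set \<Rightarrow> (real^'n \<Rightarrow> real) \<Rightarrow> (real^'n \<Rightarrow> real^'n) \<Rightarrow> bool" where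
  "has_weak_gradient \<Omega> f g \<longleftrightarrow>
     (\<forall>i. (\<lambda>x. g x $ i) \<in> L2 \<Omega>) \<and>
     (\<forall>\<phi>\<in>test_functions \<Omega>. \<forall>i.
        (\<integral>x. f x * pderiv_at i \<phi> x \<partial>lebesgue_on \<Omega>) = - (\<integral>x. g x $ i * \<phi> x \<partial>lebesgue_on \<Omega>))"

definition H1 :: "(real^'n) set \<Rightarrow> (real^'n \<Rightarrow> real) set" where
  "H1 \<Omega> = {f \<in> L2 \<Omega>. \<exists>g. has_weak_gradient \<Omega> f g}"

text \<open>The weak gradient is determined up to null sets.\<close>

definition weak_grad :: "(real^'n) set \<Rightarrow> (real^'n \<Rightarrow> real) \<Rightarrow> real^'n \<Rightarrow> real^'n" where
  "weak_grad \<Omega> f = (SOME g. has_weak_gradient \<Omega> f g)"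

definition H1_norm :: "(real^'n) set \<Rightarrow> (real^'n \<Rightarrow> real) \<Rightarrow> real" where
  "H1_norm \<Omega> f = sqrt ((\<integral>x. (f x)\<^sup>2 \<partial>lebesgue_on \<Omega>)
     + (\<Sum>i\<in>UNIV. \<integral>x. (weak_grad \<Omega> f x $ i)\<^sup>2 \<partial>lebesgue_on \<Omega>))"

definition H10 :: "(real^'n) set \<Rightarrow> (real^'n \<Rightarrow> real) set" where
  "H10 \<Omega> = {f \<in> H1 \<Omega>. \<exists>\<phi>. (\<forall>m::nat. \<phi> m \<in> test_functions \<Omega>) \<and>
                  (\<lambda>m. H1_norm \<Omega> (\<lambda>x. \<phi> m x - f x)) \<longlonglongrightarrow> 0}"

text \<open>An element of \<open>H\<^sup>-\<^sup>1(\<Omega>)\<close>, the dual of \<open>H\<^sup>1\<^sub>0(\<Omega>)\<close>, is represented by its values on \<open>H10 \<Omega>\<close>, and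
  \<open>emb \<Omega>\<close> is the canonical embedding of \<open>L\<^sup>2(\<Omega>)\<close> into it. Equations in \<open>H\<^sup>-\<^sup>1(\<Omega>)\<close> are
  weak formulations with homogeneous Dirichlet conditions.\<close>

definition Hm1_eq :: "(real^'n) set \<Rightarrow> ((real^'n \<Rightarrow> real) \<Rightarrow> real) \<Rightarrow> ((real^'n \<Rightarrow> real) \<Rightarrow> real) \<Rightarrow> bool"
  where "Hm1_eq \<Omega> F G \<longleftrightarrow> (\<forall>v\<in>H10 \<Omega>. F v = G v)"

definition emb :: "(real^'n) set \<Rightarrow> (real^'n \<Rightarrow> real) \<Rightarrow> (real^'n \<Rightarrow> real) \<Rightarrow> real" where
  "emb \<Omega> f v = (\<integral>x. f x * v x \<partial>lebesgue_on \<Omega>)"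

text \<open>\<open>DiffOp a c b e\<close> stands for the second-order linear differential operator in divergence form
  \<open>y \<mapsto> - div (a \<nabla>y + y c) + b \<bullet> \<nabla>y + e y\<close>; for instance, \<open>- \<Delta>\<close> is
  \<open>DiffOp (\<lambda>_. mat 1) (\<lambda>_. 0) (\<lambda>_. 0) (\<lambda>_. 0)\<close>.\<close>

datatype 'n diffop = DiffOp
  (coeff_a: "real^'n \<Rightarrow> real^'n^'n") (coeff_c: "real^'n \<Rightarrow> real^'n")
  (coeff_b: "real^'n \<Rightarrow> real^'n") (coeff_e: "real^'n \<Rightarrow> real")

definition formal_adjoint :: "('n::finite) diffop \<Rightarrow> ('n::finite) diffop" where
  "formal_adjoint A = DiffOp (\<lambda>x. transpose (coeff_a A x)) (coeff_b A) (coeff_c A) (coeff_e A)"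

definition op_density ::
    "(real^'n) set \<Rightarrow> ('n::finite) diffop \<Rightarrow> (real^'n \<Rightarrow> real) \<Rightarrow> (real^'n \<Rightarrow> real) \<Rightarrow> real^'n \<Rightarrow> real" where
  "op_density \<Omega> A y v x =
     (coeff_a A x *v weak_grad \<Omega> y x + y x *\<^sub>R coeff_c A x) \<bullet> weak_grad \<Omega> v x
     + (coeff_b A x \<bullet> weak_grad \<Omega> y x + coeff_e A x * y x) * v x"

text \<open>The element \<open>A y\<close> of \<open>H\<^sup>-\<^sup>1(\<Omega>)\<close>, obtained from the formal expression by integration by parts
  against \<open>v\<close>.\<close>

definition app_op ::
    "(real^'n) set \<Rightarrow> ('n::finite) diffop \<Rightarrow> (real^'n \<Rightarrow> real) \<Rightarrow> (real^'n \<Rightarrow> real) \<Rightarrow> real" where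
  "app_op \<Omega> A y v = (\<integral>x. op_density \<Omega> A y v x \<partial>lebesgue_on \<Omega>)"

text \<open>The coefficients are measurable and define a bounded operator from \<open>H\<^sup>1\<^sub>0(\<Omega>)\<close> to \<open>H\<^sup>-\<^sup>1(\<Omega>)\<close>. This
  always holds for essentially bounded coefficients.\<close>

definition bounded_diffop :: "(real^'n) set \<Rightarrow> ('n::finite) diffop \<Rightarrow> bool" where
  "bounded_diffop \<Omega> A \<longleftrightarrow>
     (\<forall>i j. (\<lambda>x. coeff_a A x $ i $ j) \<in> borel_measurable (lebesgue_on \<Omega>)) \<and>
     (\<forall>i. (\<lambda>x. coeff_c A x $ i) \<in> borel_measurable (lebesgue_on \<Omega>)) \<and>
     (\<forall>i. (\<lambda>x. coeff_b A x $ i) \<in> borel_measurable (lebesgue_on \<Omega>)) \<and>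
     coeff_e A \<in> borel_measurable (lebesgue_on \<Omega>) \<and>
     (\<forall>y\<in>H10 \<Omega>. \<forall>v\<in>H10 \<Omega>. integrable (lebesgue_on \<Omega>) (op_density \<Omega> A y v)) \<and>
     (\<exists>C. \<forall>y\<in>H10 \<Omega>. \<forall>v\<in>H10 \<Omega>. \<bar>app_op \<Omega> A y v\<bar> \<le> C * H1_norm \<Omega> y * H1_norm \<Omega> v)"

definition uniquely_solvable :: "(real^'n) set \<Rightarrow> ('n::finite) diffop \<Rightarrow> bool" where
  "uniquely_solvable \<Omega> A \<longleftrightarrow>
     (\<forall>f\<in>L2 \<Omega>. \<exists>y\<in>H10 \<Omega>. Hm1_eq \<Omega> (app_op \<Omega> A y) (emb \<Omega> f) \<and>
        (\<forall>y'\<in>H10 \<Omega>. Hm1_eq \<Omega> (app_op \<Omega> A y') (emb \<Omega> f) \<longrightarrow> ae_eq \<Omega> y' y))"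

text \<open>In what follows the values \<open>u\<^sub>1 < \<dots> < u\<^sub>d\<close> are given by \<open>w :: nat \<Rightarrow> real\<close> on \<open>{1..d}\<close>.\<close>

definition Q :: "real \<Rightarrow> real \<Rightarrow> nat \<Rightarrow> (nat \<Rightarrow> real) \<Rightarrow> nat \<Rightarrow> real set" where
  "Q \<alpha> \<gamma> d w i =
     (if i = 1 then {q. q < \<alpha> / 2 * ((1 + 2 * (\<gamma> / \<alpha>)) * w 1 + w 2)}
      else if i = d then {q. q > \<alpha> / 2 * (w (d - 1) + (1 + 2 * (\<gamma> / \<alpha>)) * w d)}
      else {q. \<alpha> / 2 * (w (i - 1) + (1 + 2 * (\<gamma> / \<alpha>)) * w i) < q \<and>
               q < \<alpha> / 2 * ((1 + 2 * (\<gamma> / \<alpha>)) * w i + w (i + 1))})"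

text \<open>The set \<open>Q\<^sub>i\<^sub>,\<^sub>i\<^sub>+\<^sub>1\<close>.\<close>

definition Qint :: "real \<Rightarrow> real \<Rightarrow> (nat \<Rightarrow> real) \<Rightarrow> nat \<Rightarrow> real set" where
  "Qint \<alpha> \<gamma> w i =
     {q. \<alpha> / 2 * ((1 + 2 * (\<gamma> / \<alpha>)) * w i + w (i + 1)) \<le> q \<and>
         q \<le> \<alpha> / 2 * (w i + (1 + 2 * (\<gamma> / \<alpha>)) * w (i + 1))}"

text \<open>For \<open>\<alpha>, \<gamma> > 0\<close>, \<open>d \<ge> 2\<close> and strictly increasing values, the above sets partition the real line,
  so that exactly one clause of the description applies.\<close>

definition H_gamma :: "real \<Rightarrow> real \<Rightarrow> nat \<Rightarrow> (nat \<Rightarrow> real) \<Rightarrow> (real^'n \<Rightarrow> real) \<Rightarrow> real^'n \<Rightarrow> real" where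
  "H_gamma \<alpha> \<gamma> d w p x = (THE r.
     (\<exists>i\<in>{1..d}. p x \<in> Q \<alpha> \<gamma> d w i \<and> r = w i) \<or>
     (\<exists>i\<in>{1..<d}. p x \<in> Qint \<alpha> \<gamma> w i \<and> r = 1 / \<gamma> * (p x - \<alpha> / 2 * (w i + w (i + 1)))))"

definition DN_H_gamma :: "real \<Rightarrow> real \<Rightarrow> nat \<Rightarrow> (nat \<Rightarrow> real) \<Rightarrow>
    (real^'n \<Rightarrow> real) \<Rightarrow> (real^'n \<Rightarrow> real) \<Rightarrow> real^'n \<Rightarrow> real" where
  "DN_H_gamma \<alpha> \<gamma> d w p h x =
     (if \<exists>i\<in>{1..<d}. p x \<in> Qint \<alpha> \<gamma> w i then 1 / \<gamma> * h x else 0)"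

text \<open>The three rows of the Newton system for the step from \<open>(u, y, p)\<close> to \<open>(u', y', p')\<close>; they are
  equations in \<open>H\<^sup>-\<^sup>1(\<Omega>)\<close>.\<close>

definition newton_system :: "(real^'n) set \<Rightarrow> ('n::finite) diffop \<Rightarrow> (real^'n \<Rightarrow> real) \<Rightarrow>
    real \<Rightarrow> real \<Rightarrow> nat \<Rightarrow> (nat \<Rightarrow> real) \<Rightarrow>
    (real^'n \<Rightarrow> real) \<Rightarrow> (real^'n \<Rightarrow> real) \<Rightarrow> (real^'n \<Rightarrow> real) \<Rightarrow>
    (real^'n \<Rightarrow> real) \<Rightarrow> (real^'n \<Rightarrow> real) \<Rightarrow> (real^'n \<Rightarrow> real) \<Rightarrow> bool" where
  "newton_system \<Omega> A z \<alpha> \<gamma> d w u y p u' y' p' \<longleftrightarrow>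
     Hm1_eq \<Omega>
       (\<lambda>v. - emb \<Omega> (\<lambda>x. u' x - u x) v + app_op \<Omega> A (\<lambda>x. y' x - y x) v)
       (\<lambda>v. - (app_op \<Omega> A y v - emb \<Omega> u v)) \<and>
     Hm1_eq \<Omega>
       (\<lambda>v. emb \<Omega> (\<lambda>x. y' x - y x) v + app_op \<Omega> (formal_adjoint A) (\<lambda>x. p' x - p x) v)
       (\<lambda>v. - (app_op \<Omega> (formal_adjoint A) p v + emb \<Omega> y v - emb \<Omega> z v)) \<and>
     Hm1_eq \<Omega>
       (\<lambda>v. app_op \<Omega> A (\<lambda>x. y' x - y x) v
              - emb \<Omega> (DN_H_gamma \<alpha> \<gamma> d w p (\<lambda>x. p' x - p x)) v)
       (\<lambda>v. - (app_op \<Omega> A y v - emb \<Omega> (H_gamma \<alpha> \<gamma> d w p) v))"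

definition Qk :: "(real^'n) set \<Rightarrow> real \<Rightarrow> real \<Rightarrow> nat \<Rightarrow> (nat \<Rightarrow> real) \<Rightarrow> (real^'n \<Rightarrow> real) \<Rightarrow>
    nat \<Rightarrow> (real^'n) set" where
  "Qk \<Omega> \<alpha> \<gamma> d w p i = {x \<in> \<Omega>. p x \<in> Q \<alpha> \<gamma> d w i}"

definition Qkint :: "(real^'n) set \<Rightarrow> real \<Rightarrow> real \<Rightarrow> (nat \<Rightarrow> real) \<Rightarrow> (real^'n \<Rightarrow> real) \<Rightarrow>
    nat \<Rightarrow> (real^'n) set" where
  "Qkint \<Omega> \<alpha> \<gamma> w p i = {x \<in> \<Omega>. p x \<in> Qint \<alpha> \<gamma> w i}"

text \<open>The active sets are those of \<open>p\<close>. The first two equations hold in \<open>H\<^sup>-\<^sup>1(\<Omega>)\<close>, the last two in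
  \<open>L\<^sup>2(\<Omega>)\<close>.\<close>

definition active_set_system :: "(real^'n) set \<Rightarrow> ('n::finite) diffop \<Rightarrow> (real^'n \<Rightarrow> real) \<Rightarrow>
    real \<Rightarrow> real \<Rightarrow> nat \<Rightarrow> (nat \<Rightarrow> real) \<Rightarrow> (real^'n \<Rightarrow> real) \<Rightarrow>
    (real^'n \<Rightarrow> real) \<Rightarrow> (real^'n \<Rightarrow> real) \<Rightarrow> (real^'n \<Rightarrow> real) \<Rightarrow> (real^'n \<Rightarrow> real) \<Rightarrow> bool" where
  "active_set_system \<Omega> A z \<alpha> \<gamma> d w p u' y' p' l' \<longleftrightarrow>
     Hm1_eq \<Omega> (\<lambda>v. app_op \<Omega> A y' v - emb \<Omega> u' v) (\<lambda>v. 0) \<and>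
     Hm1_eq \<Omega> (\<lambda>v. app_op \<Omega> (formal_adjoint A) p' v + emb \<Omega> y' v - emb \<Omega> z v) (\<lambda>v. 0) \<and>
     ae_eq \<Omega> (\<lambda>x. - p' x + \<gamma> * u' x + \<alpha> * l' x) (\<lambda>x. 0) \<and>
     ae_eq \<Omega>
       (\<lambda>x. (1 - (\<Sum>i=1..d. indicat_real (Qk \<Omega> \<alpha> \<gamma> d w p i) x)) * l' x
          + (1 - (\<Sum>i=1..<d. indicat_real (Qkint \<Omega> \<alpha> \<gamma> w p i) x)) * u' x)
       (\<lambda>x. (\<Sum>i=1..d. indicat_real (Qk \<Omega> \<alpha> \<gamma> d w p i) x * w i)
          + 1 / 2 * (\<Sum>i=1..<d. indicat_real (Qkint \<Omega> \<alpha> \<gamma> w p i) x * (w i + w (i + 1))))"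

end

theory Submission
  imports Defs
begin

text \<open>The first two rows of the Newton system are linear and reproduce the state and adjoint
  equations. Subtracting the first row from the third leaves an identity between \<open>L\<^sup>2\<close> functions tested
  against \<open>H\<^sup>1\<^sub>0(\<Omega>)\<close>, namely \<open>u' = H\<^sub>\<gamma>(p) + D\<^sub>N H\<^sub>\<gamma>(p) (p' - p)\<close>, which therefore holds almost everywhere.
  The sets \<open>Q\<^sub>i\<close> and \<open>Q\<^sub>i\<^sub>,\<^sub>i\<^sub>+\<^sub>1\<close> partition the line, and on each of them this identity is the last
  active set equation for \<open>\<lambda> = (p' - \<gamma> u') / \<alpha>\<close>, the only multiplier that the third one admits.

  The weak gradient is a choice, so linearity of \<open>A\<close> requires its uniqueness, hence the fundamental
  lemma of the calculus of variations. It is obtained from products of functions \<open>exp (- 1 / t)\<close>, which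
  converge boundedly to indicators of boxes.\<close>

section \<open>The partition of the line\<close>

locale breakpoints =
  fixes \<alpha> \<gamma> :: real and d :: nat and w :: "nat \<Rightarrow> real"
  assumes \<alpha>_pos: "\<alpha> > 0" and \<gamma>_pos: "\<gamma> > 0" and d_ge_2: "d \<ge> 2"
    and w_mono: "strict_mono_on {1..d} w"
begin

text \<open>The endpoints \<open>lo i\<close> and \<open>hi i\<close> of \<open>Qint\<close> are the
  points where the affine piece of \<open>H_gamma\<close> takes the values \<open>w i\<close> and
  \<open>w (i + 1)\<close>; the quotient \<open>\<gamma> / \<alpha>\<close> is cancelled.\<close>

definition lo :: "nat \<Rightarrow> real" where
  "lo i = \<alpha> / 2 * (w i + w (i + 1)) + \<gamma> * w i"

definition hi :: "nat \<Rightarrow> real" where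
  "hi i = \<alpha> / 2 * (w i + w (i + 1)) + \<gamma> * w (i + 1)"

lemma w_less: "i < j \<Longrightarrow> 1 \<le> i \<Longrightarrow> j \<le> d \<Longrightarrow> w i < w j"
  using w_mono by (auto simp: strict_mono_on_def)

lemma lo_less_hi: "i \<in> {1..<d} \<Longrightarrow> lo i < hi i"
  using w_less[of i "i + 1"] \<gamma>_pos by (auto simp: lo_def hi_def)

text \<open>The terms with \<alpha> increase strictly with the index, those with \<gamma> only
  weakly, since \<open>w (i + 1)\<close> and \<open>w j\<close> may coincide.\<close>

lemma hi_less_lo:
  assumes "1 \<le> i" "i < j" "j < d"
  shows "hi i < lo j"
proof -
  have "w i < w j" "w (i + 1) < w (j + 1)" using assms by (auto intro!: w_less)
  moreover have "w (i + 1) \<le> w j"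
    using assms w_less[of "i + 1" j] by (cases "i + 1 = j") auto
  ultimately show ?thesis using \<alpha>_pos \<gamma>_pos unfolding lo_def hi_def
    by (intro add_less_le_mono mult_strict_left_mono mult_left_mono) auto
qed

lemma breakpoint_eqs:
  "\<alpha> / 2 * ((1 + 2 * (\<gamma> / \<alpha>)) * w i + w (i + 1)) = lo i"
  "\<alpha> / 2 * (w i + (1 + 2 * (\<gamma> / \<alpha>)) * w (i + 1)) = hi i"
  using \<alpha>_pos by (simp_all add: lo_def hi_def field_simps)

lemma Qint_iff: "q \<in> Qint \<alpha> \<gamma> w i \<longleftrightarrow> lo i \<le> q \<and> q \<le> hi i"
  by (simp only: Qint_def breakpoint_eqs mem_Collect_eq)

text \<open>Quantifying over all intervals on either side removes the special roles of the first and
  the last index, for which one quantifier is vacuous. Disjointness and covering then concern only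
  the order of the endpoints.\<close>

lemma Q_iff:
  assumes "i \<in> {1..d}"
  shows "q \<in> Q \<alpha> \<gamma> d w i \<longleftrightarrow> (\<forall>j\<in>{1..<i}. hi j < q) \<and> (\<forall>j\<in>{i..<d}. q < lo j)"
proof -
  \<comment> \<open>The endpoints are monotone, so only the nearest interval on each side
    matters.\<close>
  have lo_mono: "lo i \<le> lo j" if "1 \<le> i" "i \<le> j" "j < d" for i j
    using that lo_less_hi[of i] hi_less_lo[of i j] by (cases "i = j") auto
  have hi_mono: "hi i \<le> hi j" if "1 \<le> i" "i \<le> j" "j < d" for i j
    using that lo_less_hi[of j] hi_less_lo[of i j] by (cases "i = j") auto
  have hi_iff: "(\<forall>j\<in>{1..<i}. hi j < q) \<longleftrightarrow> i = 1 \<or> hi (i - 1) < q"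
  proof (cases "i = 1")
    case False
    have "hi j \<le> hi (i - 1)" if "j \<in> {1..<i}" for j
      using that assms by (intro hi_mono) auto
    then show ?thesis using assms False
      by (intro iffI ballI disjI2) (auto intro: le_less_trans)
  qed simp
  have lo_iff: "(\<forall>j\<in>{i..<d}. q < lo j) \<longleftrightarrow> i = d \<or> q < lo i"
  proof (cases "i = d")
    case False
    have "lo i \<le> lo j" if "j \<in> {i..<d}" for j
      using that assms by (intro lo_mono) auto
    then show ?thesis using assms False
      by (intro iffI ballI disjI2) (auto intro: less_le_trans)
  qed simp
  have "\<alpha> / 2 * ((1 + 2 * (\<gamma> / \<alpha>)) * w i + w (i + 1)) = lo i"
    "1 < i \<Longrightarrow> \<alpha> / 2 * (w (i - 1) + (1 + 2 * (\<gamma> / \<alpha>)) * w i) = hi (i - 1)"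
    using breakpoint_eqs(1)[of i] breakpoint_eqs(2)[of "i - 1"] by simp_all
  then show ?thesis
    using assms d_ge_2 unfolding hi_iff lo_iff Q_def by (auto simp: numeral_2_eq_2)
qed

text \<open>For i < j the interval with index i separates the two sets: points of the second exceed
  \<open>hi i\<close>, those of the first stay below \<open>lo i\<close>.\<close>

lemma Q_disjoint:
  "i \<in> {1..d} \<Longrightarrow> j \<in> {1..d} \<Longrightarrow> q \<in> Q \<alpha> \<gamma> d w i \<Longrightarrow> q \<in> Q \<alpha> \<gamma> d w j \<Longrightarrow> i = j"
proof (induction i j rule: linorder_wlog)
  case (le i j)
  show ?case
  proof (rule ccontr)
    assume "i \<noteq> j"
    then have "hi i < q" "q < lo i" using le by (auto simp: Q_iff)
    then show False using lo_less_hi[of i] le \<open>i \<noteq> j\<close> by auto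
  qed
next
  case (sym i j)
  show ?case using sym(1)[OF sym(3,2,5,4)] by (rule HOL.sym)
qed

lemma Qint_disjoint:
  "i \<in> {1..<d} \<Longrightarrow> j \<in> {1..<d} \<Longrightarrow> q \<in> Qint \<alpha> \<gamma> w i \<Longrightarrow> q \<in> Qint \<alpha> \<gamma> w j \<Longrightarrow> i = j"
proof (induction i j rule: linorder_wlog)
  case (le i j)
  then show ?case using hi_less_lo[of i j] by (cases "i = j") (auto simp: Qint_iff)
next
  case (sym i j)
  show ?case using sym(1)[OF sym(3,2,5,4)] by (rule HOL.sym)
qed

lemma Q_Qint_disjoint:
  assumes "i \<in> {1..d}" "j \<in> {1..<d}" "q \<in> Q \<alpha> \<gamma> d w i"
  shows "q \<notin> Qint \<alpha> \<gamma> w j"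
proof -
  have "hi j < q \<or> q < lo j" using assms Q_iff[OF assms(1), of q] by (cases "j < i") auto
  then show ?thesis by (auto simp: Qint_iff)
qed

text \<open>The intervals lying entirely to the left of q form an initial segment, and their number
  determines the piece that contains q.\<close>

lemma Q_Qint_cases:
  obtains i where "i \<in> {1..d}" "q \<in> Q \<alpha> \<gamma> d w i"
    | i where "i \<in> {1..<d}" "q \<in> Qint \<alpha> \<gamma> w i"
proof -
  define J where "J = {j \<in> {1..<d}. hi j < q}"
  \<comment> \<open>The first interval not entirely to the left of q; the index is d if all d - 1
    intervals are.\<close>
  define i where "i = Suc (card J)"
  have J_down: "k \<in> J" if "j \<in> J" "1 \<le> k" "k \<le> j" for j k
    using that hi_less_lo[of k j] lo_less_hi[of j] by (cases "k = j") (auto simp: J_def)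
  have J: "J = {1..<i}"
  proof (cases "J = {}")
    case False
    have fin: "finite J" by (simp add: J_def)
    have "J = {1..Max J}"
    proof (intro equalityI subsetI)
      fix k assume "k \<in> J"
      then show "k \<in> {1..Max J}" using Max_ge[OF fin] by (auto simp: J_def)
    qed (use J_down[OF Max_in[OF fin False]] in auto)
    then show ?thesis unfolding i_def
      by (metis atLeastLessThanSuc_atLeastAtMost card_atLeastAtMost diff_Suc_1)
  next
    case True
    then show ?thesis by (simp add: i_def)
  qed
  have "card J \<le> card {1..<d}" unfolding J_def by (intro card_mono) auto
  then have i: "i \<in> {1..d}" using d_ge_2 by (auto simp: i_def)
  have below: "\<forall>j\<in>{1..<i}. hi j < q" using J by (auto simp: J_def)
  show ?thesis
  proof (cases "\<forall>j\<in>{i..<d}. q < lo j")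
    case True
    then show ?thesis using that(1) i below Q_iff by blast
  next
    case False
    then obtain j where j: "i \<le> j" "j < d" "lo j \<le> q" by (auto simp: not_less)
    have "i \<notin> J" by (simp add: J)
    then have "q \<le> hi i" using i j by (auto simp: J_def)
    moreover have "lo i \<le> q"
      using j i hi_less_lo[of i j] lo_less_hi[of i] by (cases "i = j") auto
    ultimately show ?thesis using that(2)[of i] i j by (auto simp: Qint_iff)
  qed
qed

section \<open>Values of \<open>H_gamma\<close> and of its Newton derivative on the pieces\<close>

lemma H_gamma_Q:
  assumes "i \<in> {1..d}" "p x \<in> Q \<alpha> \<gamma> d w i"
  shows "H_gamma \<alpha> \<gamma> d w p x = w i"
  unfolding H_gamma_def
  using assms Q_disjoint[of i _ "p x"] Q_Qint_disjoint[of i _ "p x"] by (intro the_equality) blast+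

lemma H_gamma_Qint:
  assumes "i \<in> {1..<d}" "p x \<in> Qint \<alpha> \<gamma> w i"
  shows "H_gamma \<alpha> \<gamma> d w p x = 1 / \<gamma> * (p x - \<alpha> / 2 * (w i + w (i + 1)))"
  unfolding H_gamma_def
  using assms Qint_disjoint[of i _ "p x"] Q_Qint_disjoint[of _ i "p x"]
  by (intro the_equality) blast+

text \<open>The weights \<open>f\<close> serve for the values, the affine pieces and, as the
  constant 1, the bare indicator sums of the active set system.\<close>

lemma sum_indicators_Q:
  assumes "i \<in> {1..d}" "q \<in> Q \<alpha> \<gamma> d w i"
  shows "(\<Sum>j=1..d. indicat_real (Q \<alpha> \<gamma> d w j) q * f j) = f i"
    and "(\<Sum>j=1..<d. indicat_real (Qint \<alpha> \<gamma> w j) q * f j) = 0"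
proof -
  have "(\<Sum>j=1..d. indicat_real (Q \<alpha> \<gamma> d w j) q * f j) = (\<Sum>j=1..d. if j = i then f j else 0)"
    using assms Q_disjoint by (intro sum.cong refl) (fastforce simp: indicator_def)
  then show "(\<Sum>j=1..d. indicat_real (Q \<alpha> \<gamma> d w j) q * f j) = f i"
    using assms by simp
  show "(\<Sum>j=1..<d. indicat_real (Qint \<alpha> \<gamma> w j) q * f j) = 0"
    using Q_Qint_disjoint[OF assms(1) _ assms(2)] by (intro sum.neutral) (auto simp: indicator_def)
qed

lemma sum_indicators_Qint:
  assumes "i \<in> {1..<d}" "q \<in> Qint \<alpha> \<gamma> w i"
  shows "(\<Sum>j=1..d. indicat_real (Q \<alpha> \<gamma> d w j) q * f j) = 0"
    and "(\<Sum>j=1..<d. indicat_real (Qint \<alpha> \<gamma> w j) q * f j) = f i"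
proof -
  show "(\<Sum>j=1..d. indicat_real (Q \<alpha> \<gamma> d w j) q * f j) = 0"
    using Q_Qint_disjoint[OF _ assms(1)] assms(2) by (intro sum.neutral) (auto simp: indicator_def)
  have "(\<Sum>j=1..<d. indicat_real (Qint \<alpha> \<gamma> w j) q * f j) = (\<Sum>j=1..<d. if j = i then f j else 0)"
    using assms Qint_disjoint by (intro sum.cong refl) (fastforce simp: indicator_def)
  then show "(\<Sum>j=1..<d. indicat_real (Qint \<alpha> \<gamma> w j) q * f j) = f i"
    using assms by simp
qed

lemmas sum_indicators_Q_one = sum_indicators_Q[where f="\<lambda>_. 1", simplified mult_1_right]
lemmas sum_indicators_Qint_one = sum_indicators_Qint[where f="\<lambda>_. 1", simplified mult_1_right]

text \<open>Replaces the definite description by a finite sum of products with Borel indicators of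
  \<open>p x\<close>, from which square integrability can be read off.\<close>

lemma H_gamma_eq_sum:
  "H_gamma \<alpha> \<gamma> d w p x =
     (\<Sum>i=1..d. indicat_real (Q \<alpha> \<gamma> d w i) (p x) * w i)
     + (\<Sum>i=1..<d. indicat_real (Qint \<alpha> \<gamma> w i) (p x) * (1 / \<gamma> * (p x - \<alpha> / 2 * (w i + w (i + 1)))))"
proof (cases "p x" rule: Q_Qint_cases)
  case (1 i)
  show ?thesis unfolding sum_indicators_Q[OF 1] H_gamma_Q[where p=p and x=x, OF 1] by simp
next
  case (2 i)
  show ?thesis unfolding sum_indicators_Qint[OF 2] H_gamma_Qint[where p=p and x=x, OF 2] by simp
qed

lemma DN_H_gamma_eq_sum:
  "DN_H_gamma \<alpha> \<gamma> d w p h x = (\<Sum>i=1..<d. indicat_real (Qint \<alpha> \<gamma> w i) (p x)) * (1 / \<gamma> * h x)"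
proof (cases "p x" rule: Q_Qint_cases)
  case (1 i)
  then have "\<not> (\<exists>j\<in>{1..<d}. p x \<in> Qint \<alpha> \<gamma> w j)" using Q_Qint_disjoint by blast
  then show ?thesis unfolding sum_indicators_Q_one[OF 1] DN_H_gamma_def by simp
next
  case (2 i)
  then have "\<exists>j\<in>{1..<d}. p x \<in> Qint \<alpha> \<gamma> w j" by blast
  then show ?thesis unfolding sum_indicators_Qint_one[OF 2] DN_H_gamma_def by simp
qed

text \<open>On \<open>Qk\<close> the coefficient of \<open>l'\<close> vanishes and the row reads
  \<open>u' x = w i\<close>, the Newton derivative being zero there. On \<open>Qkint\<close> the
  coefficient of \<open>u'\<close> vanishes and the row prescribes \<open>l' x\<close>, which the
  third equation \<open>l\<close> converts into a value of \<open>u' x\<close>.\<close>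

lemma active_set_row_iff:
  assumes "x \<in> \<Omega>" and l: "- p' x + \<gamma> * u' x + \<alpha> * l' x = 0"
  shows "(1 - (\<Sum>i=1..d. indicat_real (Qk \<Omega> \<alpha> \<gamma> d w p i) x)) * l' x
          + (1 - (\<Sum>i=1..<d. indicat_real (Qkint \<Omega> \<alpha> \<gamma> w p i) x)) * u' x
        = (\<Sum>i=1..d. indicat_real (Qk \<Omega> \<alpha> \<gamma> d w p i) x * w i)
          + 1 / 2 * (\<Sum>i=1..<d. indicat_real (Qkint \<Omega> \<alpha> \<gamma> w p i) x * (w i + w (i + 1)))
      \<longleftrightarrow> u' x = H_gamma \<alpha> \<gamma> d w p x + DN_H_gamma \<alpha> \<gamma> d w p (\<lambda>x. p' x - p x) x"
proof -
  have Qk: "indicat_real (Qk \<Omega> \<alpha> \<gamma> d w p i) x = indicat_real (Q \<alpha> \<gamma> d w i) (p x)"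
    "indicat_real (Qkint \<Omega> \<alpha> \<gamma> w p i) x = indicat_real (Qint \<alpha> \<gamma> w i) (p x)" for i
    using assms(1) by (auto simp: Qk_def Qkint_def indicator_def)
  show ?thesis
  proof (cases "p x" rule: Q_Qint_cases)
    case (1 i)
    show ?thesis
      unfolding Qk DN_H_gamma_eq_sum H_gamma_Q[where p=p and x=x, OF 1] sum_indicators_Q[OF 1] sum_indicators_Q_one[OF 1]
      by simp
  next
    case (2 i)
    have "l' x = 1 / 2 * (w i + w (i + 1)) \<longleftrightarrow> \<alpha> * l' x = \<alpha> * (1 / 2 * (w i + w (i + 1)))"
      using \<alpha>_pos by (metis less_irrefl mult_left_cancel)
    also have "\<dots> \<longleftrightarrow> \<gamma> * u' x = p' x - \<alpha> / 2 * (w i + w (i + 1))"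
      using l by (auto simp: algebra_simps)
    \<comment> \<open>The old value \<open>p x\<close> is inserted and cancels, which exhibits the
      affine value plus the Newton increment.\<close>
    also have "\<dots> \<longleftrightarrow> u' x = 1 / \<gamma> * (p x - \<alpha> / 2 * (w i + w (i + 1))) + 1 / \<gamma> * (p' x - p x)"
      using \<gamma>_pos by (simp add: field_simps)
    finally show ?thesis
      unfolding Qk DN_H_gamma_eq_sum H_gamma_Qint[where p=p and x=x, OF 2] sum_indicators_Qint[OF 2]
        sum_indicators_Qint_one[OF 2] by simp
  qed
qed

lemma Q_borel: "Q \<alpha> \<gamma> d w i \<in> sets borel"
  unfolding Q_def by auto

lemma Qint_borel: "Qint \<alpha> \<gamma> w i \<in> sets borel"
  unfolding Qint_def by auto

end

section \<open>Smooth bump functions\<close>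

text \<open>The factors \<open>t\<^sup>-\<^sup>k\<close> make the family closed under differentiation up to linear combinations.\<close>

definition exp_bump :: "nat \<Rightarrow> real \<Rightarrow> real" where
  "exp_bump k t = (if t \<le> 0 then 0 else inverse t ^ k * exp (- inverse t))"

lemma exp_bump_tendsto_0: "(exp_bump k \<longlongrightarrow> 0) (at_right 0)"
proof -
  have "((\<lambda>t. inverse t ^ k / exp (inverse t)) \<longlongrightarrow> 0) (at_right (0::real))"
    by (rule filterlim_compose[OF tendsto_power_div_exp_0 filterlim_inverse_at_top_right])
  moreover have "eventually (\<lambda>t. inverse t ^ k / exp (inverse t) = exp_bump k t) (at_right (0::real))"
    using eventually_at_right_less[of 0]
    by eventually_elim (simp add: exp_bump_def exp_minus field_simps)
  ultimately show ?thesis by (rule Lim_transform_eventually)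
qed

text \<open>For positive t this is the product rule, and for negative t both sides vanish. At 0 the
  right difference quotient of order k is the bump of order k + 1, which tends to 0.\<close>

lemma DERIV_exp_bump:
  "(exp_bump k has_real_derivative exp_bump (k + 2) t - real k * exp_bump (k + 1) t) (at t)"
proof -
  consider "t < 0" | "t = 0" | "t > 0" by linarith
  then show ?thesis
  proof cases
    case 1
    have "((\<lambda>_. 0) has_real_derivative 0) (at t)" by simp
    then have "(exp_bump k has_real_derivative 0) (at t)"
      by (rule has_field_derivative_transform_within_open[where S="{..<0}"])
         (use 1 in \<open>auto simp: exp_bump_def\<close>)
    then show ?thesis using 1 by (simp add: exp_bump_def)
  next
    case 2
    have "((\<lambda>h. (exp_bump k (0 + h) - exp_bump k 0) / h) \<longlongrightarrow> 0) (at 0)"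
      unfolding filterlim_at_split
    proof
      show "((\<lambda>h. (exp_bump k (0 + h) - exp_bump k 0) / h) \<longlongrightarrow> 0) (at_left 0)"
        by (rule tendsto_eventually)
           (use eventually_at_left_real[of "-1" 0] in \<open>auto elim!: eventually_mono simp: exp_bump_def\<close>)
      have "eventually (\<lambda>h. exp_bump (k + 1) h = (exp_bump k (0 + h) - exp_bump k 0) / h) (at_right 0)"
        using eventually_at_right_less[of 0]
        by eventually_elim (simp add: exp_bump_def field_simps)
      then show "((\<lambda>h. (exp_bump k (0 + h) - exp_bump k 0) / h) \<longlongrightarrow> 0) (at_right 0)"
        by (rule Lim_transform_eventually[OF exp_bump_tendsto_0])
    qed
    then show ?thesis using 2 by (simp add: DERIV_def exp_bump_def)
  next
    case 3
    have "((\<lambda>t. inverse t ^ k * exp (- inverse t)) has_real_derivative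
        exp_bump (k + 2) t - real k * exp_bump (k + 1) t) (at t)"
      using 3 by (auto intro!: derivative_eq_intros simp: exp_bump_def)
        (cases k; simp add: field_simps power2_eq_square)
    then show ?thesis
      by (rule has_field_derivative_transform_within_open[where S="{0<..}"])
         (use 3 in \<open>auto simp: exp_bump_def\<close>)
  qed
qed

text \<open>A class of differentiable functions closed under partial derivatives absorbs the
  induction over lists of directions hidden in \<open>smooth\<close>.\<close>

lemma smooth_coinduct:
  assumes "f \<in> S" and "\<And>f x. f \<in> S \<Longrightarrow> f differentiable (at x)"
    and "\<And>f i. f \<in> S \<Longrightarrow> pderiv_at i f \<in> S"
  shows "smooth f"
proof -
  have "f \<in> S \<Longrightarrow> iter_pderiv is f differentiable (at x)" for "is" x f
    by (induction "is" f rule: iter_pderiv.induct) (auto simp: assms)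
  then show ?thesis using assms(1) by (simp add: smooth_def)
qed

lemma smooth_pderiv_at: "smooth f \<Longrightarrow> smooth (pderiv_at i f)"
  unfolding smooth_def by (metis iter_pderiv.simps(2))

lemma smooth_differentiable: "smooth f \<Longrightarrow> f differentiable (at x)"
  unfolding smooth_def by (metis iter_pderiv.simps(1))

lemma smooth_continuous: "smooth f \<Longrightarrow> continuous_on UNIV f"
  by (simp add: continuous_at_imp_continuous_on differentiable_imp_continuous_within smooth_differentiable)

lemma continuous_lebesgue_on_measurable:
  fixes f :: "'a::euclidean_space \<Rightarrow> real"
  assumes "continuous_on UNIV f"
  shows "f \<in> borel_measurable (lebesgue_on S)"
  using assms by (intro measurable_restrict_space1 measurable_completion) 
    (simp add: borel_measurable_continuous_onI)

text \<open>The orders k are unrestricted because differentiation raises them; a negative scale s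
  reflects the bump so that it can cut off from above.\<close>

inductive_set bump_alg :: "(real^'n::finite \<Rightarrow> real) set" where
  const: "(\<lambda>_. c) \<in> bump_alg"
| exp_bump: "(\<lambda>x. exp_bump k (s * (x $ i - a))) \<in> bump_alg"
| add: "f \<in> bump_alg \<Longrightarrow> g \<in> bump_alg \<Longrightarrow> (\<lambda>x. f x + g x) \<in> bump_alg"
| mult: "f \<in> bump_alg \<Longrightarrow> g \<in> bump_alg \<Longrightarrow> (\<lambda>x. f x * g x) \<in> bump_alg"

lemma has_derivative_pderiv_at: "(f has_derivative f') (at x) \<Longrightarrow> pderiv_at i f x = f' (axis i 1)"
  unfolding pderiv_at_def by (metis frechet_derivative_at)

lemma has_derivative_exp_bump_coord:
  "((\<lambda>x. exp_bump k (s * (x $ i - a))) has_derivative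
     (\<lambda>h. (exp_bump (k + 2) (s * (x $ i - a)) - real k * exp_bump (k + 1) (s * (x $ i - a)))
       * (s * h $ i))) (at x)"
proof -
  have "((\<lambda>x. s * (x $ i - a)) has_derivative (\<lambda>h. s * h $ i)) (at x)"
    by (auto intro!: derivative_eq_intros bounded_linear.has_derivative[OF bounded_linear_vec_nth])
  from has_derivative_compose[OF this DERIV_exp_bump[unfolded has_field_derivative_def]]
  show ?thesis by simp
qed

lemma bump_alg_differentiable: "f \<in> bump_alg \<Longrightarrow> f differentiable (at x)"
  by (induction rule: bump_alg.induct)
     (auto intro: differentiable_add differentiable_mult differentiableI has_derivative_exp_bump_coord)

lemma pderiv_at_add:
  "f differentiable (at x) \<Longrightarrow> g differentiable (at x) \<Longrightarrow>
    pderiv_at i (\<lambda>x. f x + g x) x = pderiv_at i f x + pderiv_at i g x"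
  unfolding pderiv_at_def
  by (subst frechet_derivative_at[symmetric, OF has_derivative_add])
     (auto simp: frechet_derivative_works[symmetric])

lemma pderiv_at_mult:
  "f differentiable (at x) \<Longrightarrow> g differentiable (at x) \<Longrightarrow>
    pderiv_at i (\<lambda>x. f x * g x) x = f x * pderiv_at i g x + pderiv_at i f x * g x"
  unfolding pderiv_at_def
  by (subst frechet_derivative_at[symmetric, OF has_derivative_mult])
     (auto simp: frechet_derivative_works[symmetric])

lemma bump_alg_pderiv_at: "f \<in> bump_alg \<Longrightarrow> pderiv_at i f \<in> bump_alg"
proof (induction rule: bump_alg.induct)
  case (const c)
  have "pderiv_at i (\<lambda>_. c) = (\<lambda>_::real^'a. 0)"
    by (rule ext) (simp add: pderiv_at_def)
  then show ?case by (simp add: bump_alg.const)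
next
  case (exp_bump k s j a)
  \<comment> \<open>Subtraction is written as addition of a multiple by \<open>- real k\<close>,
    since the algebra is generated with sums, products and constants.\<close>
  have "pderiv_at i (\<lambda>x. exp_bump k (s * (x $ j - a))) =
      (\<lambda>x. (exp_bump (k + 2) (s * (x $ j - a)) + (- real k) * exp_bump (k + 1) (s * (x $ j - a)))
       * (s * (axis i 1 :: real^'a) $ j))"
    by (rule ext) (simp add: has_derivative_pderiv_at[OF has_derivative_exp_bump_coord])
  also have "\<dots> \<in> bump_alg" by (intro bump_alg.intros)
  finally show ?case .
next
  case (add f g)
  then have "pderiv_at i (\<lambda>x. f x + g x) = (\<lambda>x. pderiv_at i f x + pderiv_at i g x)"
    by (intro ext pderiv_at_add bump_alg_differentiable)
  then show ?case using add by (auto intro: bump_alg.add)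
next
  case (mult f g)
  then have "pderiv_at i (\<lambda>x. f x * g x) = (\<lambda>x. f x * pderiv_at i g x + pderiv_at i f x * g x)"
    by (intro ext pderiv_at_mult bump_alg_differentiable)
  then show ?case using mult by (auto intro: bump_alg.add bump_alg.mult)
qed

lemma bump_alg_smooth: "f \<in> bump_alg \<Longrightarrow> smooth f"
  by (rule smooth_coinduct[of f bump_alg]) (auto intro: bump_alg_differentiable bump_alg_pderiv_at)

lemma bump_alg_prod: "finite I \<Longrightarrow> (\<And>i. i \<in> I \<Longrightarrow> f i \<in> bump_alg) \<Longrightarrow> (\<lambda>x. \<Prod>i\<in>I. f i x) \<in> bump_alg"
  by (induction I rule: finite_induct) (auto intro: bump_alg.intros)

section \<open>Smooth approximation of indicators of boxes\<close>

text \<open>Two opposite flanks per coordinate. Inside the box each factor is exp (-1 / (m t)) with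
  t the distance to a face, so for positive m the nonzero set is the open box, and the values tend
  to 1 there as m grows.\<close>

definition box_bump :: "real^'n \<Rightarrow> real^'n \<Rightarrow> nat \<Rightarrow> real^'n::finite \<Rightarrow> real" where
  "box_bump a b m x =
     (\<Prod>i\<in>UNIV. exp_bump 0 (real m * (x $ i - a $ i)) * exp_bump 0 (- real m * (x $ i - b $ i)))"

lemma smooth_box_bump: "smooth (box_bump a b m)"
  unfolding box_bump_def by (intro bump_alg_smooth bump_alg_prod bump_alg.intros) auto

lemma exp_bump_0_bounds: "0 \<le> exp_bump 0 t" "exp_bump 0 t \<le> 1"
  by (auto simp: exp_bump_def)

lemma box_bump_bounds: "0 \<le> box_bump a b m x" "box_bump a b m x \<le> 1"
  unfolding box_bump_def
  by (auto intro!: prod_nonneg prod_le_1 mult_le_one simp: exp_bump_0_bounds)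

lemma box_bump_eq_0:
  assumes "x \<notin> box a b"
  shows "box_bump a b m x = 0"
proof -
  obtain i where "x $ i \<le> a $ i \<or> b $ i \<le> x $ i"
    using assms by (auto simp: mem_box_cart not_less)
  then have "real m * (x $ i - a $ i) \<le> 0 \<or> - real m * (x $ i - b $ i) \<le> 0"
    by (auto simp: mult_nonneg_nonpos)
  then show ?thesis
    unfolding box_bump_def by (intro prod_zero) (auto intro!: bexI[of _ i] simp: exp_bump_def)
qed

lemma exp_bump_0_tendsto_1: "t > 0 \<Longrightarrow> (\<lambda>m. exp_bump 0 (real m * t)) \<longlonglongrightarrow> 1"
proof -
  assume t: "t > 0"
  have "filterlim (\<lambda>m. real m * t) at_top sequentially"
    using filterlim_tendsto_pos_mult_at_top[OF tendsto_const t filterlim_real_sequentially]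
    by (simp add: mult.commute)
  then have "(\<lambda>m. exp (- inverse (real m * t))) \<longlonglongrightarrow> exp (- 0)"
    by (intro tendsto_exp tendsto_minus tendsto_inverse_0_at_top)
  \<comment> \<open>At m = 0 the two sides differ: \<open>inverse 0 = 0\<close> makes the
    exponential 1, while \<open>exp_bump 0 0 = 0\<close>.\<close>
  moreover have "eventually (\<lambda>m. exp (- inverse (real m * t)) = exp_bump 0 (real m * t)) sequentially"
    using eventually_gt_at_top[of 0]
    by eventually_elim (use t in \<open>auto simp: exp_bump_def mult_le_0_iff\<close>)
  ultimately show ?thesis by (auto intro: Lim_transform_eventually)
qed

lemma box_bump_tendsto: "(\<lambda>m. box_bump a b m x) \<longlonglongrightarrow> indicat_real (box a b) x"
proof (cases "x \<in> box a b")
  case True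
  then have pos: "x $ i - a $ i > 0" "b $ i - x $ i > 0" for i by (auto simp: mem_box_cart)
  have eq: "- real m * (x $ i - b $ i) = real m * (b $ i - x $ i)" for m i by (simp add: algebra_simps)
  have "(\<lambda>m. box_bump a b m x) \<longlonglongrightarrow> (\<Prod>i\<in>(UNIV::'a set). 1 * 1)"
    unfolding box_bump_def eq by (intro tendsto_prod tendsto_mult exp_bump_0_tendsto_1 pos)
  then show ?thesis using True by simp
qed (simp add: box_bump_eq_0)

text \<open>The hypothesis is on the closed box because the closure of the nonzero set may reach the
  faces.\<close>

lemma box_bump_test_function:
  assumes "cbox a b \<subseteq> \<Omega>"
  shows "box_bump a b m \<in> test_functions \<Omega>"
proof -
  have "{x. box_bump a b m x \<noteq> 0} \<subseteq> cbox a b"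
    using box_bump_eq_0 box_subset_cbox by blast
  then have "closure {x. box_bump a b m x \<noteq> 0} \<subseteq> cbox a b"
    by (intro closure_minimal) auto
  moreover from this have "compact (closure {x. box_bump a b m x \<noteq> 0})"
    by (metis closed_Int_compact closed_closure compact_cbox inf.absorb1)
  ultimately show ?thesis using assms smooth_box_bump by (auto simp: test_functions_def)
qed

section \<open>Square integrable functions\<close>

lemma L2_measurable: "f \<in> L2 \<Omega> \<Longrightarrow> f \<in> borel_measurable (lebesgue_on \<Omega>)"
  by (simp add: L2_def)

lemma L2_mult_integrable:
  assumes "f \<in> L2 \<Omega>" "g \<in> L2 \<Omega>"
  shows "integrable (lebesgue_on \<Omega>) (\<lambda>x. f x * g x)"
proof (rule Bochner_Integration.integrable_bound)
  show "integrable (lebesgue_on \<Omega>) (\<lambda>x. (f x)\<^sup>2 + (g x)\<^sup>2)"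
    using assms by (auto simp: L2_def)
  have "\<bar>f x * g x\<bar> \<le> (f x)\<^sup>2 + (g x)\<^sup>2" for x
  proof -
    have "2 * \<bar>f x * g x\<bar> \<le> (f x)\<^sup>2 + (g x)\<^sup>2"
      using sum_squares_bound[of "\<bar>f x\<bar>" "\<bar>g x\<bar>"] by (simp add: abs_mult mult.assoc)
    then show ?thesis using abs_ge_zero[of "f x * g x"] by linarith
  qed
  then show "AE x in lebesgue_on \<Omega>. norm (f x * g x) \<le> norm ((f x)\<^sup>2 + (g x)\<^sup>2)"
    by simp
qed (use assms in \<open>auto simp: L2_def\<close>)

lemma L2_add:
  assumes "f \<in> L2 \<Omega>" "g \<in> L2 \<Omega>"
  shows "(\<lambda>x. f x + g x) \<in> L2 \<Omega>"
  using assms L2_mult_integrable[OF assms]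
  by (auto simp: L2_def power2_sum mult.assoc intro!: Bochner_Integration.integrable_add)

lemma L2_bounded_mult:
  assumes [measurable]: "b \<in> borel_measurable (lebesgue_on \<Omega>)" and "\<And>x. \<bar>b x\<bar> \<le> C" and f: "f \<in> L2 \<Omega>"
  shows "(\<lambda>x. b x * f x) \<in> L2 \<Omega>"
proof -
  have [measurable]: "f \<in> borel_measurable (lebesgue_on \<Omega>)" using f by (rule L2_measurable)
  have "integrable (lebesgue_on \<Omega>) (\<lambda>x. (b x * f x)\<^sup>2)"
  proof (rule Bochner_Integration.integrable_bound)
    show "integrable (lebesgue_on \<Omega>) (\<lambda>x. C\<^sup>2 * (f x)\<^sup>2)" using f by (auto simp: L2_def)
    have "(b x)\<^sup>2 \<le> C\<^sup>2" for x using assms(2)[of x] by (simp add: abs_le_square_iff[symmetric])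
    then show "AE x in lebesgue_on \<Omega>. norm ((b x * f x)\<^sup>2) \<le> norm (C\<^sup>2 * (f x)\<^sup>2)"
      by (simp add: power_mult_distrib mult_right_mono)
  qed measurable
  then show ?thesis by (simp add: L2_def)
qed

lemma L2_cmult: "f \<in> L2 \<Omega> \<Longrightarrow> (\<lambda>x. c * f x) \<in> L2 \<Omega>"
  by (rule L2_bounded_mult[of "\<lambda>_. c" _ "\<bar>c\<bar>"]) auto

lemma L2_diff:
  assumes "f \<in> L2 \<Omega>" "g \<in> L2 \<Omega>"
  shows "(\<lambda>x. f x - g x) \<in> L2 \<Omega>"
  using L2_add[OF assms(1) L2_cmult[OF assms(2), of "-1"]] by simp

lemma L2_sum: "finite I \<Longrightarrow> (\<And>i. i \<in> I \<Longrightarrow> f i \<in> L2 \<Omega>) \<Longrightarrow> (\<lambda>x. \<Sum>i\<in>I. f i x) \<in> L2 \<Omega>"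
proof (induction I rule: finite_induct)
  case empty
  then show ?case by (simp add: L2_def)
qed (simp add: L2_add)

lemma L2_bounded:
  assumes "\<Omega> \<in> lmeasurable" "b \<in> borel_measurable (lebesgue_on \<Omega>)" "\<And>x. \<bar>b x\<bar> \<le> C"
  shows "b \<in> L2 \<Omega>"
proof -
  interpret finite_measure "lebesgue_on \<Omega>" using assms(1) by (rule finite_measure_lebesgue_on)
  have "(\<lambda>_. 1) \<in> L2 \<Omega>" by (simp add: L2_def)
  from L2_bounded_mult[OF assms(2,3) this] show ?thesis by simp
qed

lemma L2_integrable:
  assumes "\<Omega> \<in> lmeasurable" "f \<in> L2 \<Omega>"
  shows "integrable (lebesgue_on \<Omega>) f"
  using L2_mult_integrable[OF assms(2) L2_bounded[OF assms(1), of "\<lambda>_. 1" 1]] by simp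

section \<open>The fundamental lemma of the calculus of variations\<close>

text \<open>Open boxes form an intersection-stable generator of the Borel sets, and the Borel sets
  with vanishing integral form a Dynkin system; \<open>total\<close> provides its
  complements.\<close>

lemma set_integral_borel_eq_0:
  fixes g :: "'a::euclidean_space \<Rightarrow> real"
  assumes g: "integrable lborel g" and total: "(\<integral>x. g x \<partial>lborel) = 0"
    and box: "\<And>a b. (\<integral>x\<in>box a b. g x \<partial>lborel) = 0"
    and A: "A \<in> sets borel"
  shows "(\<integral>x\<in>A. g x \<partial>lborel) = 0"
proof -
  let ?G = "range (\<lambda>(a, b). box a b :: 'a set)"
  have G: "sets (borel :: 'a measure) = sigma_sets UNIV ?G"
    unfolding borel_eq_box by (rule sets_measure_of) simp
  have set_int: "set_integrable lborel A g" if "A \<in> sets borel" for A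
    using that g unfolding set_integrable_def by (intro integrable_mult_indicator) auto
  have "Int_stable ?G"
    by (rule Int_stableI) (auto simp: box_Int_box image_def, blast)
  moreover have "?G \<subseteq> Pow UNIV" "A \<in> sigma_sets UNIV ?G" using A G by auto
  ultimately show ?thesis
  proof (induction A rule: sigma_sets_induct_disjoint)
    case (basic A)
    then show ?case using box by auto
  next
    case (compl A)
    then have [measurable]: "A \<in> sets borel" by (simp add: G)
    have "indicat_real (UNIV - A) x *\<^sub>R g x = g x - indicat_real A x *\<^sub>R g x" for x
      by (simp add: indicator_def)
    then have "(\<integral>x\<in>UNIV - A. g x \<partial>lborel) = (\<integral>x. g x \<partial>lborel) - (\<integral>x\<in>A. g x \<partial>lborel)"
      using g set_int[of A] unfolding set_lebesgue_integral_def set_integrable_def by simp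
    then show ?case using compl total by simp
  next
    case (union A)
    then have A: "A i \<in> sets borel" for i by (auto simp: G)
    then have "(\<integral>x\<in>(\<Union>i. A i). g x \<partial>lborel) = (\<Sum>i. \<integral>x\<in>A i. g x \<partial>lborel)"
      using union by (intro lebesgue_integral_countable_add set_int)
        (auto simp: disjoint_family_on_def)
    then show ?case using union by simp
  qed (simp add: set_lebesgue_integral_def)
qed

text \<open>A Borel version h of g makes uniqueness of densities on \<open>lborel\<close>
  applicable: its integral vanishes over every Borel set because it does so over boxes and over the
  whole space.\<close>

lemma AE_eq_0_of_box_integrals:
  fixes g :: "'a::euclidean_space \<Rightarrow> real"
  assumes g: "integrable lebesgue g" and total: "(\<integral>x. g x \<partial>lebesgue) = 0"
    and box: "\<And>a b. (\<integral>x. indicat_real (box a b) x * g x \<partial>lebesgue) = 0"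
  shows "AE x in lebesgue. g x = 0"
proof -
  obtain h where h[measurable]: "h \<in> borel_measurable lborel" and ae: "AE x in lborel. g x = h x"
    using completion_ex_borel_measurable_real[of g lborel] g by auto
  have ae': "AE x in lebesgue. g x = h x" using ae by (rule AE_completion)
  have [measurable]: "g \<in> borel_measurable lebesgue" using g by simp
  have [measurable]: "h \<in> borel_measurable lebesgue" using measurable_completion[OF h] .
  have int_h: "integrable lborel h"
    using g ae' by (subst integrable_completion[symmetric, OF h], subst integrable_cong_AE[of h _ g]) auto
  have eq: "(\<integral>x. b x * h x \<partial>lborel) = (\<integral>x. b x * g x \<partial>lebesgue)"
    if b[measurable]: "b \<in> borel_measurable lborel" for b
  proof -
    have [measurable]: "b \<in> borel_measurable lebesgue" using measurable_completion[OF b] .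
    have "(\<integral>x. b x * h x \<partial>lborel) = (\<integral>x. b x * h x \<partial>lebesgue)"
      by (rule integral_completion[symmetric]) measurable
    also have "\<dots> = (\<integral>x. b x * g x \<partial>lebesgue)"
      by (rule integral_cong_AE) (use ae' in auto)
    finally show ?thesis .
  qed
  have "(\<integral>x\<in>A. h x \<partial>lborel) = (\<integral>x\<in>A. 0 \<partial>lborel)" if "A \<in> sets lborel" for A
    using set_integral_borel_eq_0[OF int_h, of A] eq[of "\<lambda>_. 1"] total that
      eq[of "indicat_real (box _ _)"] box
    by (simp add: set_lebesgue_integral_def)
  from density_unique_real[OF int_h _ this] have "AE x in lborel. h x = 0" by simp
  then have "AE x in lebesgue. h x = 0" by (rule AE_completion)
  with ae' show ?thesis by eventually_elim simp
qed

text \<open>Bumps yield vanishing integrals over boxes whose closed box lies in \<Omega>. Inside one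
  such box this makes g vanish almost everywhere, and countably many of these boxes cover
  \<Omega>.\<close>

lemma fundamental_lemma_of_variations:
  fixes g :: "real^'n::finite \<Rightarrow> real"
  assumes "open \<Omega>" and g: "integrable (lebesgue_on \<Omega>) g"
    and test: "\<And>\<phi>. \<phi> \<in> test_functions \<Omega> \<Longrightarrow> (\<integral>x. g x * \<phi> x \<partial>lebesgue_on \<Omega>) = 0"
  shows "AE x in lebesgue_on \<Omega>. g x = 0"
proof -
  have \<Omega>: "\<Omega> \<inter> space lebesgue \<in> sets lebesgue" using assms(1) by simp
  define h where "h x = indicat_real \<Omega> x * g x" for x
  have h: "integrable lebesgue h"
    using g by (simp add: integrable_restrict_space[OF \<Omega>] h_def[abs_def])
  have [measurable]: "h \<in> borel_measurable lebesgue" using h by simp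
  have box: "(\<integral>x. indicat_real (box a b) x * h x \<partial>lebesgue) = 0" if ab: "cbox a b \<subseteq> \<Omega>" for a b
  proof (rule LIMSEQ_unique)
    have [measurable]: "box_bump a b m \<in> borel_measurable lebesgue" for m
      using continuous_lebesgue_on_measurable[OF smooth_continuous[OF smooth_box_bump], of _ _ _ UNIV]
      by (simp add: lebesgue_on_UNIV_eq)
    have [measurable]: "box a b \<in> sets lebesgue" by simp
    show "(\<lambda>m. \<integral>x. box_bump a b m x * h x \<partial>lebesgue) \<longlonglongrightarrow> (\<integral>x. indicat_real (box a b) x * h x \<partial>lebesgue)"
    proof (rule integral_dominated_convergence[where w="\<lambda>x. \<bar>h x\<bar>"])
      show "AE x in lebesgue. (\<lambda>m. box_bump a b m x * h x) \<longlonglongrightarrow> indicat_real (box a b) x * h x"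
        by (intro AE_I2 tendsto_mult box_bump_tendsto tendsto_const)
      show "AE x in lebesgue. norm (box_bump a b m x * h x) \<le> \<bar>h x\<bar>" for m
        using box_bump_bounds[of a b m] by (auto simp: abs_mult intro!: mult_left_le_one_le)
    qed (use h in auto)
    have "(\<integral>x. box_bump a b m x * h x \<partial>lebesgue) = (\<integral>x. g x * box_bump a b m x \<partial>lebesgue_on \<Omega>)" for m
      by (subst integral_restrict_space[OF \<Omega>]) (simp add: h_def mult_ac)
    then show "(\<lambda>m. \<integral>x. box_bump a b m x * h x \<partial>lebesgue) \<longlonglongrightarrow> 0"
      using test[OF box_bump_test_function[OF ab]] by simp
  qed
  have ae: "AE x in lebesgue. x \<in> box a b \<longrightarrow> g x = 0" if ab: "cbox a b \<subseteq> \<Omega>" for a b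
  proof -
    have "AE x in lebesgue. indicat_real (box a b) x * h x = 0"
    proof (rule AE_eq_0_of_box_integrals)
      show "integrable lebesgue (\<lambda>x. indicat_real (box a b) x * h x)"
        using h integrable_mult_indicator[of "box a b" lebesgue h] by simp
      fix c d
      \<comment> \<open>Corners of the intersection of the two boxes; its closed box stays in
        \<open>cbox a b\<close>, hence in \<Omega>, whatever c and d are.\<close>
      define e f where "e = (\<Sum>i\<in>Basis. max (c \<bullet> i) (a \<bullet> i) *\<^sub>R i)"
        and "f = (\<Sum>i\<in>Basis. min (d \<bullet> i) (b \<bullet> i) *\<^sub>R i)"
      have "box c d \<inter> box a b = box e f" unfolding e_def f_def by (rule box_Int_box)
      then have ind: "indicat_real (box c d) x * (indicat_real (box a b) x * h x) = indicat_real (box e f) x * h x" for x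
        by (auto simp: indicator_def)
      have "cbox e f \<subseteq> cbox a b" by (auto simp: mem_box e_def f_def)
      with ab have "cbox e f \<subseteq> \<Omega>" by simp
      then show "(\<integral>x. indicat_real (box c d) x * (indicat_real (box a b) x * h x) \<partial>lebesgue) = 0"
        unfolding ind by (rule box)
    qed (rule box[OF ab])
    moreover have "box a b \<subseteq> \<Omega>" using ab box_subset_cbox by blast
    ultimately show ?thesis by (elim eventually_mono) (auto simp: h_def indicator_def split: if_splits)
  qed
  define F where "F = {box a b | a b. cbox a b \<subseteq> \<Omega>}"
  have "\<Union>F = \<Omega>"
  proof
    show "\<Union>F \<subseteq> \<Omega>" using box_subset_cbox by (force simp: F_def)
    show "\<Omega> \<subseteq> \<Union>F"
    proof
      fix x assume "x \<in> \<Omega>"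
      with assms(1) obtain a b where "cbox a b \<subseteq> \<Omega>" "x \<in> box a b"
        using open_contains_cbox by metis
      then show "x \<in> \<Union>F" by (auto simp: F_def)
    qed
  qed
  \<comment> \<open>A countable subcover keeps the union of the exceptional sets null.\<close>
  moreover obtain F' where F': "F' \<subseteq> F" "countable F'" "\<Union>F' = \<Union>F"
    using Lindelof[of F] by (auto simp: F_def)
  moreover have "AE x in lebesgue. \<forall>X\<in>F'. x \<in> X \<longrightarrow> g x = 0"
    using F'(1,2) by (subst AE_ball_countable) (auto simp: F_def intro!: ae)
  ultimately have "AE x in lebesgue. x \<in> \<Omega> \<longrightarrow> g x = 0"
    by (elim eventually_mono) blast
  then show ?thesis by (simp add: AE_restrict_space_iff[OF \<Omega>])
qed

section \<open>Weak gradients\<close>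

lemma mem_closure_support: "f x \<noteq> 0 \<Longrightarrow> x \<in> closure {x. f x \<noteq> 0}"
  by (rule subsetD[OF closure_subset]) simp

lemma continuous_compact_support_bounded:
  fixes f :: "'a::euclidean_space \<Rightarrow> real"
  assumes "continuous_on UNIV f" "compact (closure {x. f x \<noteq> 0})"
  obtains C where "\<And>x. \<bar>f x\<bar> \<le> C"
proof -
  have "compact (f ` closure {x. f x \<noteq> 0})"
    by (rule compact_continuous_image[OF continuous_on_subset[OF assms(1) subset_UNIV] assms(2)])
  then obtain C where C: "\<And>y. y \<in> f ` closure {x. f x \<noteq> 0} \<Longrightarrow> norm y \<le> C"
    by (meson bounded_iff compact_imp_bounded)
  \<comment> \<open>The absolute value covers an empty support, for which C may be negative.\<close>
  have "\<bar>f x\<bar> \<le> \<bar>C\<bar>" for x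
  proof (cases "f x = 0")
    case False
    then have "x \<in> closure {x. f x \<noteq> 0}" by (rule mem_closure_support)
    then have "norm (f x) \<le> C" by (intro C imageI)
    then show ?thesis by simp
  qed simp
  then show ?thesis by (rule that)
qed

text \<open>Off the closed support f vanishes on a neighbourhood, so its derivative is zero there.
  This is what makes partial derivatives of test functions test functions again.\<close>

lemma pderiv_at_support:
  "closure {x. pderiv_at i f x \<noteq> 0} \<subseteq> closure {x. f x \<noteq> 0}"
proof (rule closure_minimal)
  show "{x. pderiv_at i f x \<noteq> 0} \<subseteq> closure {x. f x \<noteq> 0}"
  proof (rule subsetI, rule ccontr)
    fix x assume "x \<in> {x. pderiv_at i f x \<noteq> 0}" and x: "x \<notin> closure {x. f x \<noteq> 0}"
    have "(f has_derivative (\<lambda>_. 0)) (at x)"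
    proof (rule has_derivative_transform_within_open[where f="\<lambda>_. 0"])
      show "open (- closure {x. f x \<noteq> 0})" by auto
      show "0 = f y" if "y \<in> - closure {x. f x \<noteq> 0}" for y
        using that mem_closure_support[of f y] by auto
    qed (use x in auto)
    from has_derivative_pderiv_at[OF this] \<open>x \<in> {x. pderiv_at i f x \<noteq> 0}\<close> show False by simp
  qed
qed simp

lemma test_function_pderiv_at: "\<phi> \<in> test_functions \<Omega> \<Longrightarrow> pderiv_at i \<phi> \<in> test_functions \<Omega>"
proof -
  assume \<phi>: "\<phi> \<in> test_functions \<Omega>"
  then have "compact (closure {x. \<phi> x \<noteq> 0} \<inter> closure {x. pderiv_at i \<phi> x \<noteq> 0})"
    by (intro compact_Int_closed) (auto simp: test_functions_def)
  then show ?thesis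
    using \<phi> pderiv_at_support[of i \<phi>] smooth_pderiv_at[of \<phi> i]
    by (auto simp: test_functions_def inf.absorb2)
qed

lemma test_function_L2:
  assumes "\<Omega> \<in> lmeasurable" "\<phi> \<in> test_functions \<Omega>"
  shows "\<phi> \<in> L2 \<Omega>"
proof -
  have "continuous_on UNIV \<phi>" using assms(2) by (simp add: test_functions_def smooth_continuous)
  moreover obtain C where "\<And>x. \<bar>\<phi> x\<bar> \<le> C"
    using continuous_compact_support_bounded[OF \<open>continuous_on UNIV \<phi>\<close>] assms(2)
    by (auto simp: test_functions_def)
  ultimately show ?thesis
    using assms(1) by (intro L2_bounded continuous_lebesgue_on_measurable)
qed

lemma pderiv_at_along_line:
  assumes "F differentiable (at (x + t *\<^sub>R axis i 1))"
  shows "((\<lambda>s. F (x + s *\<^sub>R axis i 1)) has_real_derivative pderiv_at i F (x + t *\<^sub>R axis i 1)) (at t)"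
proof -
  let ?F' = "frechet_derivative F (at (x + t *\<^sub>R axis i 1))"
  have F': "(F has_derivative ?F') (at (x + t *\<^sub>R axis i 1))"
    using assms frechet_derivative_works by blast
  have "((\<lambda>s. x + s *\<^sub>R axis i 1) has_derivative (\<lambda>h. h *\<^sub>R axis i 1)) (at t)"
    by (auto intro!: derivative_eq_intros)
  from has_derivative_compose[OF this F']
  have "((\<lambda>s. F (x + s *\<^sub>R axis i 1)) has_derivative (\<lambda>h. ?F' (h *\<^sub>R axis i 1))) (at t)" .
  moreover have "?F' (h *\<^sub>R axis i 1) = pderiv_at i F (x + t *\<^sub>R axis i 1) * h" for h
    using linear_cmul[OF has_derivative_linear[OF F'], of h "axis i 1"]
    by (simp add: pderiv_at_def)
  ultimately show ?thesis by (simp add: has_field_derivative_def)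
qed

text \<open>The difference quotients in direction \<open>i\<close> have integral zero by translation invariance, and
  they converge boundedly to the partial derivative. This avoids Fubini's theorem.\<close>

lemma integral_pderiv_at_eq_0:
  fixes F :: "real^'n::finite \<Rightarrow> real"
  assumes diff: "\<And>x. F differentiable (at x)" and cont: "continuous_on UNIV (pderiv_at i F)"
    and compact: "compact (closure {x. F x \<noteq> 0})"
  shows "(\<integral>x. pderiv_at i F x \<partial>lborel) = 0"
proof -
  let ?e = "axis i (1::real) :: real^'n"
  let ?q = "\<lambda>m x. real (Suc m) * (F (x + (1 / real (Suc m)) *\<^sub>R ?e) - F x)"
  have F_cont: "continuous_on UNIV F"
    by (simp add: continuous_at_imp_continuous_on differentiable_imp_continuous_within diff)
  have [measurable]: "F \<in> borel_measurable borel" "pderiv_at i F \<in> borel_measurable borel"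
    using F_cont cont by (auto intro: borel_measurable_continuous_onI)
  have "compact (closure {x. F x \<noteq> 0} \<inter> closure {x. pderiv_at i F x \<noteq> 0})"
    using compact by (rule compact_Int_closed) simp
  then have compact': "compact (closure {x. pderiv_at i F x \<noteq> 0})"
    using pderiv_at_support[of i F] by (simp add: inf.absorb2)
  obtain C where C: "\<And>x. \<bar>pderiv_at i F x\<bar> \<le> C"
    using continuous_compact_support_bounded[OF cont compact'] by blast
  obtain B where B: "\<And>x. \<bar>F x\<bar> \<le> B"
    using continuous_compact_support_bounded[OF F_cont compact] by blast
  from compact_imp_bounded[OF compact]
  obtain R where R: "\<And>x. x \<in> closure {x. F x \<noteq> 0} \<Longrightarrow> norm x \<le> R"
    unfolding bounded_iff by blast
  have F_0: "F x = 0" if "R < norm x" for x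
    using R[of x] that mem_closure_support[of F x] by linarith
  \<comment> \<open>The radius R + 1 covers the support of F and of its translates by at most 1, so
    a multiple of this indicator dominates all the difference quotients.\<close>
  have ball: "integrable lborel (\<lambda>x::real^'n. c * indicat_real (cball 0 (R + 1)) x)" for c :: real
    using emeasure_bounded_finite[of "cball (0::real^'n) (R + 1)"]
    by (intro integrable_mult_right integrable_real_indicator) auto
  have int_F: "integrable lborel F"
  proof (rule Bochner_Integration.integrable_bound[OF ball[of B]])
    show "AE x in lborel. norm (F x) \<le> norm (B * indicat_real (cball 0 (R + 1)) x)"
    proof (rule AE_I2)
      fix x show "norm (F x) \<le> norm (B * indicat_real (cball 0 (R + 1)) x)"
        using F_0[of x] B[of x] by (cases "norm x \<le> R + 1") (auto simp: indicator_def)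
    qed
  qed simp
  have translate: "integrable lborel (\<lambda>x. F (x + c))" "(\<integral>x. F (x + c) \<partial>lborel) = (\<integral>x. F x \<partial>lborel)" for c
  proof -
    have "integrable (distr lborel borel ((+) c)) F" using int_F by (simp add: lborel_distr_plus)
    then show "integrable lborel (\<lambda>x. F (x + c))" by (simp add: integrable_distr_eq add.commute)
    have "(\<integral>x. F x \<partial>distr lborel borel ((+) c)) = (\<integral>x. F (x + c) \<partial>lborel)"
      by (simp add: integral_distr add.commute)
    then show "(\<integral>x. F (x + c) \<partial>lborel) = (\<integral>x. F x \<partial>lborel)" by (simp add: lborel_distr_plus)
  qed
  have q_0: "(\<integral>x. ?q m x \<partial>lborel) = 0" for m
    by (simp only: integral_mult_right_zero Bochner_Integration.integral_diff translate int_F)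
      (simp add: translate int_F)
  have q_bound: "\<bar>?q m x\<bar> \<le> C * indicat_real (cball 0 (R + 1)) x" for m x
  proof -
    define s where "s = 1 / real (Suc m)"
    have s: "0 < s" "s \<le> 1" by (auto simp: s_def)
    \<comment> \<open>The mean value theorem replaces the quotient by a derivative at an
      intermediate point, which gives a bound independent of m.\<close>
    have "\<exists>z>0. z < s \<and> F (x + s *\<^sub>R ?e) - F (x + 0 *\<^sub>R ?e) = (s - 0) * pderiv_at i F (x + z *\<^sub>R ?e)"
      by (rule MVT2[OF s(1)]) (rule pderiv_at_along_line[OF diff])
    then obtain z where z: "F (x + s *\<^sub>R ?e) - F x = s * pderiv_at i F (x + z *\<^sub>R ?e)" by auto
    have "?q m x = pderiv_at i F (x + z *\<^sub>R ?e)"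
      unfolding s_def[symmetric] z by (simp add: s_def)
    then have "\<bar>?q m x\<bar> \<le> C" using C by simp
    moreover have "?q m x = 0" if "R + 1 < norm x"
    proof -
      have "norm (s *\<^sub>R ?e) \<le> 1" using s by simp
      then have "R < norm (x + s *\<^sub>R ?e)"
        using that norm_triangle_ineq2[of x "- (s *\<^sub>R ?e)"] by simp
      then show ?thesis using that F_0[of x] F_0[of "x + s *\<^sub>R ?e"] by (simp add: s_def)
    qed
    ultimately show ?thesis by (cases "norm x \<le> R + 1") (auto simp: indicator_def)
  qed
  have q_lim: "(\<lambda>m. ?q m x) \<longlonglongrightarrow> pderiv_at i F x" for x
  proof -
    have "((\<lambda>s. F (x + s *\<^sub>R ?e)) has_real_derivative pderiv_at i F (x + 0 *\<^sub>R ?e)) (at 0)"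
      by (rule pderiv_at_along_line[OF diff])
    then have "((\<lambda>s. (F (x + s *\<^sub>R ?e) - F x) / s) \<longlongrightarrow> pderiv_at i F x) (at 0)"
      by (simp add: DERIV_def)
    moreover have "filterlim (\<lambda>m. 1 / real (Suc m)) (at 0) sequentially"
      using LIMSEQ_inverse_real_of_nat by (auto simp: filterlim_at divide_inverse)
    ultimately have "(\<lambda>m. (F (x + (1 / real (Suc m)) *\<^sub>R ?e) - F x) / (1 / real (Suc m)))
        \<longlonglongrightarrow> pderiv_at i F x"
      by (rule filterlim_compose)
    then show ?thesis by (simp add: mult.commute)
  qed
  have "(\<lambda>m. \<integral>x. ?q m x \<partial>lborel) \<longlonglongrightarrow> (\<integral>x. pderiv_at i F x \<partial>lborel)"
  proof (rule integral_dominated_convergence[OF _ _ ball[of C]])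
    show "AE x in lborel. norm (?q m x) \<le> C * indicat_real (cball 0 (R + 1)) x" for m
      using q_bound[of m] by simp
    show "AE x in lborel. (\<lambda>m. ?q m x) \<longlonglongrightarrow> pderiv_at i F x"
      using q_lim by simp
  qed measurable
  then show ?thesis unfolding q_0 using LIMSEQ_unique tendsto_const by blast
qed

section \<open>Existence, uniqueness and linearity of weak gradients\<close>

text \<open>Integration by parts: the derivative of the product of \<phi> and \<psi> has integral
  zero, and the product rule splits it into the two required integrals.\<close>

lemma test_function_has_weak_gradient:
  assumes \<Omega>: "\<Omega> \<in> lmeasurable" and \<phi>: "\<phi> \<in> test_functions \<Omega>"
  shows "has_weak_gradient \<Omega> \<phi> (\<lambda>x. \<chi> i. pderiv_at i \<phi> x)"
  unfolding has_weak_gradient_def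
proof (intro conjI allI ballI)
  show "(\<lambda>x. (\<chi> i. pderiv_at i \<phi> x) $ i) \<in> L2 \<Omega>" for i
    using test_function_L2[OF \<Omega> test_function_pderiv_at[OF \<phi>]] by simp
  fix \<psi> i assume \<psi>: "\<psi> \<in> test_functions \<Omega>"
  let ?F = "\<lambda>x. \<phi> x * \<psi> x"
  have smooth: "smooth \<phi>" "smooth \<psi>" using \<phi> \<psi> by (auto simp: test_functions_def)
  have F': "pderiv_at i ?F x = \<phi> x * pderiv_at i \<psi> x + pderiv_at i \<phi> x * \<psi> x" for x
    by (intro pderiv_at_mult smooth_differentiable smooth)
  have supp: "closure {x. ?F x \<noteq> 0} \<subseteq> closure {x. \<phi> x \<noteq> 0}"
    by (rule closure_mono) auto
  have cont: "continuous_on UNIV (pderiv_at i ?F)"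
    unfolding F'[abs_def] by (intro continuous_intros smooth_continuous smooth_pderiv_at smooth)
  have "(\<integral>x. pderiv_at i ?F x \<partial>lborel) = 0"
  proof (rule integral_pderiv_at_eq_0)
    show "?F differentiable (at x)" for x
      by (intro differentiable_mult smooth_differentiable smooth)
    have "compact (closure {x. \<phi> x \<noteq> 0} \<inter> closure {x. ?F x \<noteq> 0})"
      using \<phi> by (intro compact_Int_closed) (auto simp: test_functions_def)
    then show "compact (closure {x. ?F x \<noteq> 0})"
      using supp by (simp add: inf.absorb2)
  qed (rule cont)
  moreover have "pderiv_at i ?F \<in> borel_measurable lborel"
    using cont by (simp add: borel_measurable_continuous_onI)
  ultimately have "(\<integral>x. pderiv_at i ?F x \<partial>lebesgue) = 0"
    by (simp add: integral_completion)
  \<comment> \<open>The support of \<phi> lies in \<Omega>, so the integral over \<Omega> equals the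
    one over the whole space.\<close>
  moreover have ind: "indicat_real \<Omega> x *\<^sub>R pderiv_at i ?F x = pderiv_at i ?F x" for x
  proof (cases "x \<in> \<Omega>")
    case False
    then have "\<phi> x = 0" "pderiv_at i \<phi> x = 0"
      using \<phi> test_function_pderiv_at[OF \<phi>, of i] mem_closure_support[of \<phi> x]
        mem_closure_support[of "pderiv_at i \<phi>" x] by (auto simp: test_functions_def)
    then show ?thesis by (simp add: F')
  qed simp
  ultimately have "(\<integral>x. pderiv_at i ?F x \<partial>lebesgue_on \<Omega>) = 0"
    using \<Omega> by (subst integral_restrict_space) (simp, simp only: ind)
  moreover have "(\<integral>x. pderiv_at i ?F x \<partial>lebesgue_on \<Omega>) =
      (\<integral>x. \<phi> x * pderiv_at i \<psi> x \<partial>lebesgue_on \<Omega>) + (\<integral>x. pderiv_at i \<phi> x * \<psi> x \<partial>lebesgue_on \<Omega>)"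
    unfolding F' using \<Omega> \<phi> \<psi>
    by (intro Bochner_Integration.integral_add L2_mult_integrable test_function_L2 test_function_pderiv_at)
  ultimately show "(\<integral>x. \<phi> x * pderiv_at i \<psi> x \<partial>lebesgue_on \<Omega>)
      = - (\<integral>x. (\<chi> i. pderiv_at i \<phi> x) $ i * \<psi> x \<partial>lebesgue_on \<Omega>)"
    by simp
qed

lemma has_weak_gradient_diff:
  assumes "\<Omega> \<in> lmeasurable" "f \<in> L2 \<Omega>" "g \<in> L2 \<Omega>"
    and f: "has_weak_gradient \<Omega> f f'" and g: "has_weak_gradient \<Omega> g g'"
  shows "has_weak_gradient \<Omega> (\<lambda>x. f x - g x) (\<lambda>x. f' x - g' x)"
  unfolding has_weak_gradient_def
proof (intro conjI allI ballI)
  show "(\<lambda>x. (f' x - g' x) $ i) \<in> L2 \<Omega>" for i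
    using f g by (auto simp: has_weak_gradient_def intro: L2_diff)
  fix \<phi> i assume \<phi>: "\<phi> \<in> test_functions \<Omega>"
  have "\<phi> \<in> L2 \<Omega>" "pderiv_at i \<phi> \<in> L2 \<Omega>"
    using assms(1) \<phi> by (auto intro: test_function_L2 test_function_pderiv_at)
  moreover have "(\<lambda>x. f' x $ i) \<in> L2 \<Omega>" "(\<lambda>x. g' x $ i) \<in> L2 \<Omega>"
    using f g by (auto simp: has_weak_gradient_def)
  ultimately show "(\<integral>x. (f x - g x) * pderiv_at i \<phi> x \<partial>lebesgue_on \<Omega>)
      = - (\<integral>x. (f' x - g' x) $ i * \<phi> x \<partial>lebesgue_on \<Omega>)"
    using f g \<phi> assms(2,3)
    by (simp add: left_diff_distrib L2_mult_integrable has_weak_gradient_def)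
qed

lemma has_weak_gradient_unique:
  assumes "open \<Omega>" "\<Omega> \<in> lmeasurable"
    and g: "has_weak_gradient \<Omega> f g" and h: "has_weak_gradient \<Omega> f h"
  shows "AE x in lebesgue_on \<Omega>. g x = h x"
proof -
  have "AE x in lebesgue_on \<Omega>. g x $ i - h x $ i = 0" for i
  proof (rule fundamental_lemma_of_variations[OF assms(1)])
    have L2: "(\<lambda>x. g x $ i) \<in> L2 \<Omega>" "(\<lambda>x. h x $ i) \<in> L2 \<Omega>"
      using g h by (auto simp: has_weak_gradient_def)
    then show "integrable (lebesgue_on \<Omega>) (\<lambda>x. g x $ i - h x $ i)"
      using assms(2) by (auto intro: L2_integrable)
    fix \<phi> assume \<phi>: "\<phi> \<in> test_functions \<Omega>"
    then have "(\<integral>x. g x $ i * \<phi> x \<partial>lebesgue_on \<Omega>) = (\<integral>x. h x $ i * \<phi> x \<partial>lebesgue_on \<Omega>)"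
      using g h by (auto simp: has_weak_gradient_def)
    then show "(\<integral>x. (g x $ i - h x $ i) * \<phi> x \<partial>lebesgue_on \<Omega>) = 0"
      using L2 test_function_L2[OF assms(2) \<phi>] by (simp add: left_diff_distrib L2_mult_integrable)
  qed
  then have "AE x in lebesgue_on \<Omega>. \<forall>i\<in>UNIV. g x $ i - h x $ i = 0"
    by (intro AE_finite_allI) auto
  then show ?thesis by eventually_elim (simp add: vec_eq_iff)
qed

lemma has_weak_gradient_weak_grad: "has_weak_gradient \<Omega> f g \<Longrightarrow> has_weak_gradient \<Omega> f (weak_grad \<Omega> f)"
  unfolding weak_grad_def by (rule someI[of "has_weak_gradient \<Omega> f"])

text \<open>Both sides are weak gradients of the difference, so uniqueness identifies them up to a
  null set although \<open>weak_grad\<close> is an arbitrary choice.\<close>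

lemma weak_grad_diff:
  assumes "open \<Omega>" "\<Omega> \<in> lmeasurable" "f \<in> H1 \<Omega>" "g \<in> H1 \<Omega>"
  shows "AE x in lebesgue_on \<Omega>. weak_grad \<Omega> (\<lambda>x. f x - g x) x = weak_grad \<Omega> f x - weak_grad \<Omega> g x"
proof -
  have "has_weak_gradient \<Omega> (\<lambda>x. f x - g x) (\<lambda>x. weak_grad \<Omega> f x - weak_grad \<Omega> g x)"
    using assms by (intro has_weak_gradient_diff) (auto simp: H1_def intro: has_weak_gradient_weak_grad)
  from has_weak_gradient_unique[OF assms(1,2) has_weak_gradient_weak_grad[OF this] this]
  show ?thesis .
qed

text \<open>Serves the constant approximating sequence that places test functions in
  \<open>H10\<close>; the gradient chosen for 0 vanishes almost everywhere by uniqueness.\<close>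

lemma H1_norm_zero:
  assumes "open \<Omega>" "\<Omega> \<in> lmeasurable"
  shows "H1_norm \<Omega> (\<lambda>_. 0) = 0"
proof -
  have zero: "has_weak_gradient \<Omega> (\<lambda>_. 0) (\<lambda>_. 0)"
    by (simp add: has_weak_gradient_def L2_def)
  have ae: "AE x in lebesgue_on \<Omega>. weak_grad \<Omega> (\<lambda>_. 0) x = 0"
    by (rule has_weak_gradient_unique[OF assms has_weak_gradient_weak_grad[OF zero] zero])
  have "(\<integral>x. (weak_grad \<Omega> (\<lambda>_. 0) x $ i)\<^sup>2 \<partial>lebesgue_on \<Omega>) = 0" for i
    by (rule integral_eq_zero_AE) (use ae in eventually_elim, simp)
  then show ?thesis by (simp add: H1_norm_def)
qed

lemma test_functions_subset_H10:
  assumes "open \<Omega>" "\<Omega> \<in> lmeasurable"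
  shows "test_functions \<Omega> \<subseteq> H10 \<Omega>"
proof
  fix \<phi> assume \<phi>: "\<phi> \<in> test_functions \<Omega>"
  have "\<phi> \<in> H1 \<Omega>"
    using test_function_L2[OF assms(2) \<phi>] test_function_has_weak_gradient[OF assms(2) \<phi>]
    by (auto simp: H1_def)
  then show "\<phi> \<in> H10 \<Omega>"
    using \<phi> H1_norm_zero[OF assms] by (auto simp: H10_def intro!: exI[of _ "\<lambda>_. \<phi>"])
qed

text \<open>Test functions belong to \<open>H10\<close>, and by the fundamental lemma they separate
  the elements of L^2; so the embedding into H^-1 is injective.\<close>

lemma emb_eq_iff:
  assumes "open \<Omega>" "\<Omega> \<in> lmeasurable" "f \<in> L2 \<Omega>" "g \<in> L2 \<Omega>"
  shows "Hm1_eq \<Omega> (emb \<Omega> f) (emb \<Omega> g) \<longleftrightarrow> ae_eq \<Omega> f g"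
proof
  assume eq: "Hm1_eq \<Omega> (emb \<Omega> f) (emb \<Omega> g)"
  have "AE x in lebesgue_on \<Omega>. f x - g x = 0"
  proof (rule fundamental_lemma_of_variations[OF assms(1)])
    show "integrable (lebesgue_on \<Omega>) (\<lambda>x. f x - g x)"
      using assms by (auto intro: L2_integrable)
    fix \<phi> assume \<phi>: "\<phi> \<in> test_functions \<Omega>"
    then have "emb \<Omega> f \<phi> = emb \<Omega> g \<phi>"
      using eq test_functions_subset_H10[OF assms(1,2)] by (auto simp: Hm1_eq_def)
    then show "(\<integral>x. (f x - g x) * \<phi> x \<partial>lebesgue_on \<Omega>) = 0"
      using assms test_function_L2[OF assms(2) \<phi>]
      by (simp add: emb_def left_diff_distrib L2_mult_integrable)
  qed
  then show "ae_eq \<Omega> f g" by (simp add: ae_eq_def)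
next
  assume eq: "ae_eq \<Omega> f g"
  show "Hm1_eq \<Omega> (emb \<Omega> f) (emb \<Omega> g)"
    unfolding Hm1_eq_def
  proof
    fix v assume v: "v \<in> H10 \<Omega>"
    then have [measurable]: "f \<in> borel_measurable (lebesgue_on \<Omega>)" "g \<in> borel_measurable (lebesgue_on \<Omega>)"
      "v \<in> borel_measurable (lebesgue_on \<Omega>)"
      using assms by (auto simp: H10_def H1_def L2_def)
    show "emb \<Omega> f v = emb \<Omega> g v"
      unfolding emb_def using eq by (intro integral_cong_AE) (auto simp: ae_eq_def)
  qed
qed

section \<open>The differential operator and the Newton step\<close>

text \<open>Transposition moves the matrix to the other gradient, and exchanging b and c matches the
  first order terms. The adjoint form thus inherits integrability and linearity from A with its
  arguments swapped.\<close>

lemma op_density_formal_adjoint: "op_density \<Omega> (formal_adjoint A) y v = op_density \<Omega> A v y"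
proof
  fix x
  have "(transpose (coeff_a A x) *v weak_grad \<Omega> y x) \<bullet> weak_grad \<Omega> v x
      = (coeff_a A x *v weak_grad \<Omega> v x) \<bullet> weak_grad \<Omega> y x"
    unfolding transpose_matrix_vector dot_lmul_matrix by (rule inner_commute)
  then show "op_density \<Omega> (formal_adjoint A) y v x = op_density \<Omega> A v y x"
    by (simp add: op_density_def formal_adjoint_def inner_left_distrib algebra_simps)
qed

text \<open>The hypothesis is pointwise because additivity of the chosen gradients is available only
  almost everywhere.\<close>

lemma op_density_diff_left:
  assumes "weak_grad \<Omega> (\<lambda>x. f x - g x) x = weak_grad \<Omega> f x - weak_grad \<Omega> g x"
  shows "op_density \<Omega> A (\<lambda>x. f x - g x) v x = op_density \<Omega> A f v x - op_density \<Omega> A g v x"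
  unfolding op_density_def assms
  by (simp add: matrix_vector_mult_diff_distrib inner_diff_left inner_diff_right
      scaleR_diff_left inner_left_distrib algebra_simps)

lemma op_density_diff_right:
  assumes "weak_grad \<Omega> (\<lambda>x. f x - g x) x = weak_grad \<Omega> f x - weak_grad \<Omega> g x"
  shows "op_density \<Omega> A v (\<lambda>x. f x - g x) x = op_density \<Omega> A v f x - op_density \<Omega> A v g x"
  unfolding op_density_def assms by (simp add: inner_diff_right algebra_simps)

lemma H1_measurable: "f \<in> H1 \<Omega> \<Longrightarrow> f \<in> borel_measurable (lebesgue_on \<Omega>)"
  by (simp add: H1_def L2_measurable)

lemma weak_grad_measurable:
  assumes "f \<in> H1 \<Omega>"
  shows "(\<lambda>x. weak_grad \<Omega> f x $ i) \<in> borel_measurable (lebesgue_on \<Omega>)"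
proof -
  obtain g where "has_weak_gradient \<Omega> f g" using assms by (auto simp: H1_def)
  then have "has_weak_gradient \<Omega> f (weak_grad \<Omega> f)" by (rule has_weak_gradient_weak_grad)
  then show ?thesis by (simp add: has_weak_gradient_def L2_measurable)
qed

text \<open>Measurability allows the integrals of almost everywhere equal densities to be compared;
  it covers differences, which \<open>H1_diff\<close> puts into \<open>H1\<close>.\<close>

lemma op_density_measurable:
  assumes A: "bounded_diffop \<Omega> A" and "f \<in> H1 \<Omega>" "g \<in> H1 \<Omega>"
  shows "op_density \<Omega> A f g \<in> borel_measurable (lebesgue_on \<Omega>)"
proof -
  note [measurable] = assms(2,3)[THEN H1_measurable] assms(2,3)[THEN weak_grad_measurable]
  have [measurable]:
    "(\<lambda>x. coeff_a A x $ i $ j) \<in> borel_measurable (lebesgue_on \<Omega>)"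
    "(\<lambda>x. coeff_c A x $ i) \<in> borel_measurable (lebesgue_on \<Omega>)"
    "(\<lambda>x. coeff_b A x $ i) \<in> borel_measurable (lebesgue_on \<Omega>)"
    "coeff_e A \<in> borel_measurable (lebesgue_on \<Omega>)" for i j
    using A by (auto simp: bounded_diffop_def)
  show ?thesis
    unfolding op_density_def[abs_def] inner_vec_def matrix_vector_mult_def by simp
qed

lemma H1_diff:
  assumes "\<Omega> \<in> lmeasurable" "f \<in> H1 \<Omega>" "g \<in> H1 \<Omega>"
  shows "(\<lambda>x. f x - g x) \<in> H1 \<Omega>"
proof -
  obtain f' g' where "has_weak_gradient \<Omega> f f'" "has_weak_gradient \<Omega> g g'"
    using assms by (auto simp: H1_def)
  with assms have "has_weak_gradient \<Omega> (\<lambda>x. f x - g x) (\<lambda>x. f' x - g' x)"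
    by (intro has_weak_gradient_diff) (auto simp: H1_def)
  then show ?thesis using assms by (auto simp: H1_def intro: L2_diff)
qed

lemma app_op_diff:
  assumes "open \<Omega>" "\<Omega> \<in> lmeasurable" and A: "bounded_diffop \<Omega> A"
    and fgv: "f \<in> H10 \<Omega>" "g \<in> H10 \<Omega>" "v \<in> H10 \<Omega>"
  shows "app_op \<Omega> A (\<lambda>x. f x - g x) v = app_op \<Omega> A f v - app_op \<Omega> A g v"
    and "app_op \<Omega> (formal_adjoint A) (\<lambda>x. f x - g x) v =
      app_op \<Omega> (formal_adjoint A) f v - app_op \<Omega> (formal_adjoint A) g v"
proof -
  have H1: "f \<in> H1 \<Omega>" "g \<in> H1 \<Omega>" "v \<in> H1 \<Omega>" using fgv by (auto simp: H10_def)
  note grad = weak_grad_diff[OF assms(1,2) H1(1,2)]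
  note meas [measurable] = op_density_measurable[OF A]
  note diff = H1_diff[OF assms(2) H1(1,2)]
  have int: "integrable (lebesgue_on \<Omega>) (op_density \<Omega> A a b)" if "a \<in> H10 \<Omega>" "b \<in> H10 \<Omega>" for a b
    using A that by (auto simp: bounded_diffop_def)
  have "app_op \<Omega> A (\<lambda>x. f x - g x) v =
      (\<integral>x. op_density \<Omega> A f v x - op_density \<Omega> A g v x \<partial>lebesgue_on \<Omega>)"
    unfolding app_op_def using grad
    by (intro integral_cong_AE borel_measurable_diff meas H1 diff)
      (auto elim!: eventually_mono intro: op_density_diff_left)
  then show "app_op \<Omega> A (\<lambda>x. f x - g x) v = app_op \<Omega> A f v - app_op \<Omega> A g v"
    by (simp add: app_op_def int fgv)
  \<comment> \<open>After the swap the difference stands in the second argument of A, so linearity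
    in the test slot is used.\<close>
  have "app_op \<Omega> (formal_adjoint A) (\<lambda>x. f x - g x) v =
      (\<integral>x. op_density \<Omega> A v f x - op_density \<Omega> A v g x \<partial>lebesgue_on \<Omega>)"
    unfolding app_op_def op_density_formal_adjoint using grad
    by (intro integral_cong_AE borel_measurable_diff meas H1 diff)
      (auto elim!: eventually_mono intro: op_density_diff_right)
  then show "app_op \<Omega> (formal_adjoint A) (\<lambda>x. f x - g x) v =
      app_op \<Omega> (formal_adjoint A) f v - app_op \<Omega> (formal_adjoint A) g v"
    by (simp add: app_op_def op_density_formal_adjoint int fgv)
qed

lemma emb_diff:
  assumes "f \<in> L2 \<Omega>" "g \<in> L2 \<Omega>" "v \<in> L2 \<Omega>"
  shows "emb \<Omega> (\<lambda>x. f x - g x) v = emb \<Omega> f v - emb \<Omega> g v"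
  using assms by (simp add: emb_def left_diff_distrib L2_mult_integrable)

lemma emb_add:
  assumes "f \<in> L2 \<Omega>" "g \<in> L2 \<Omega>" "v \<in> L2 \<Omega>"
  shows "emb \<Omega> (\<lambda>x. f x + g x) v = emb \<Omega> f v + emb \<Omega> g v"
  using assms by (simp add: emb_def distrib_right L2_mult_integrable)

section \<open>Square integrability of the superposition operators and elimination of the
  multiplier\<close>

context breakpoints
begin

lemma indicator_mult_L2:
  assumes "S \<in> sets borel" "p \<in> borel_measurable (lebesgue_on \<Omega>)" "f \<in> L2 \<Omega>"
  shows "(\<lambda>x. indicat_real S (p x) * f x) \<in> L2 \<Omega>"
proof (rule L2_bounded_mult[OF _ _ assms(3)])
  note [measurable] = assms(1,2)
  show "(\<lambda>x. indicat_real S (p x)) \<in> borel_measurable (lebesgue_on \<Omega>)" by measurable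
  show "\<bar>indicat_real S (p x)\<bar> \<le> 1" for x by (simp add: indicator_def)
qed

lemma H_gamma_L2:
  assumes "\<Omega> \<in> lmeasurable" "p \<in> L2 \<Omega>"
  shows "H_gamma \<alpha> \<gamma> d w p \<in> L2 \<Omega>"
proof -
  have const: "(\<lambda>_. c) \<in> L2 \<Omega>" for c :: real
    by (rule L2_bounded[OF assms(1), of _ "\<bar>c\<bar>"]) auto
  show ?thesis
    unfolding H_gamma_eq_sum[abs_def] using assms(2)
    by (intro L2_add L2_sum indicator_mult_L2 L2_cmult L2_diff const Q_borel Qint_borel L2_measurable) auto
qed

lemma DN_H_gamma_L2:
  assumes "p \<in> L2 \<Omega>" "h \<in> L2 \<Omega>"
  shows "DN_H_gamma \<alpha> \<gamma> d w p h \<in> L2 \<Omega>"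
  unfolding DN_H_gamma_eq_sum[abs_def] sum_distrib_right using assms
  by (intro L2_sum indicator_mult_L2 L2_cmult Qint_borel L2_measurable) auto

lemma active_set_rows_iff:
  assumes "\<Omega> \<in> lmeasurable" "u' \<in> L2 \<Omega>" "p' \<in> L2 \<Omega>"
  shows "ae_eq \<Omega> u' (\<lambda>x. H_gamma \<alpha> \<gamma> d w p x + DN_H_gamma \<alpha> \<gamma> d w p (\<lambda>x. p' x - p x) x) \<longleftrightarrow>
     (\<exists>l'\<in>L2 \<Omega>. ae_eq \<Omega> (\<lambda>x. - p' x + \<gamma> * u' x + \<alpha> * l' x) (\<lambda>x. 0) \<and>
     ae_eq \<Omega>
       (\<lambda>x. (1 - (\<Sum>i=1..d. indicat_real (Qk \<Omega> \<alpha> \<gamma> d w p i) x)) * l' x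
          + (1 - (\<Sum>i=1..<d. indicat_real (Qkint \<Omega> \<alpha> \<gamma> w p i) x)) * u' x)
       (\<lambda>x. (\<Sum>i=1..d. indicat_real (Qk \<Omega> \<alpha> \<gamma> d w p i) x * w i)
          + 1 / 2 * (\<Sum>i=1..<d. indicat_real (Qkint \<Omega> \<alpha> \<gamma> w p i) x * (w i + w (i + 1)))))"
    (is "?N \<longleftrightarrow> (\<exists>l'\<in>L2 \<Omega>. ?R3 l' \<and> ?R4 l')")
proof -
  \<comment> \<open>The pointwise equivalence \<open>active_set_row_iff\<close> passes to almost
    every x, for any multiplier that obeys the third row.\<close>
  have iff: "?N \<longleftrightarrow> ?R4 l'" if "?R3 l'" for l'
  proof -
    have "AE x in lebesgue_on \<Omega>. x \<in> \<Omega>" using AE_space[of "lebesgue_on \<Omega>"] by simp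
    moreover have "AE x in lebesgue_on \<Omega>. - p' x + \<gamma> * u' x + \<alpha> * l' x = 0"
      using that by (simp add: ae_eq_def)
    ultimately show ?thesis unfolding ae_eq_def
      by (intro eventually_subst, eventually_elim) (simp only: active_set_row_iff)
  qed
  \<comment> \<open>The third row solved for the multiplier; it serves as the witness.\<close>
  define l where "l x = 1 / \<alpha> * (p' x - \<gamma> * u' x)" for x
  have "l \<in> L2 \<Omega>" unfolding l_def[abs_def] using assms by (intro L2_cmult L2_diff)
  moreover have "?R3 l" using \<alpha>_pos by (simp add: ae_eq_def l_def)
  ultimately show ?thesis using iff by blast
qed

end

theorem theorem5p2:
  fixes \<Omega> :: "(real^'n::finite) set" and A :: "('n::finite) diffop" and z :: "real^'n \<Rightarrow> real"
    and \<alpha> \<gamma> :: real and d :: nat and w :: "nat \<Rightarrow> real"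
    and uk yk pk u' y' p' :: "real^'n \<Rightarrow> real"
  assumes "bounded_domain \<Omega>"
    and "bounded_diffop \<Omega> A" and "uniquely_solvable \<Omega> A"
    and "z \<in> L2 \<Omega>"
    and "\<alpha> > 0" and "\<gamma> > 0"
    and "d \<ge> 2" and "strict_mono_on {1..d} w"
    and "uk \<in> L2 \<Omega>" and "yk \<in> H10 \<Omega>" and "pk \<in> H10 \<Omega>"
    and "u' \<in> L2 \<Omega>" and "y' \<in> H10 \<Omega>" and "p' \<in> H10 \<Omega>"
  shows "newton_system \<Omega> A z \<alpha> \<gamma> d w uk yk pk u' y' p' \<longleftrightarrow>
         (\<exists>l'\<in>L2 \<Omega>. active_set_system \<Omega> A z \<alpha> \<gamma> d w pk u' y' p' l')"
proof -
  interpret breakpoints \<alpha> \<gamma> d w by unfold_locales (fact assms)+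
  have "open \<Omega>" "\<Omega> \<in> lmeasurable"
    using assms(1) by (auto simp: bounded_domain_def intro: lmeasurable_open)
  note \<Omega> = this
  have L2: "v \<in> L2 \<Omega>" if "v \<in> H10 \<Omega>" for v using that by (simp add: H10_def H1_def)
  let ?H = "H_gamma \<alpha> \<gamma> d w pk" and ?D = "DN_H_gamma \<alpha> \<gamma> d w pk (\<lambda>x. p' x - pk x)"
  have HD: "?H \<in> L2 \<Omega>" "?D \<in> L2 \<Omega>"
    using \<Omega>(2) L2 assms(11,14) by (auto intro: H_gamma_L2 DN_H_gamma_L2 L2_diff)
  define R1 where "R1 \<longleftrightarrow> Hm1_eq \<Omega> (\<lambda>v. app_op \<Omega> A y' v - emb \<Omega> u' v) (\<lambda>v. 0)"
  define R2 where "R2 \<longleftrightarrow>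
    Hm1_eq \<Omega> (\<lambda>v. app_op \<Omega> (formal_adjoint A) p' v + emb \<Omega> y' v - emb \<Omega> z v) (\<lambda>v. 0)"
  \<comment> \<open>By linearity the images of the old iterate under A and its adjoint cancel, as do
    the old control and state; the third row becomes A y' = \<open>?H\<close> + \<open>?D\<close> in
    H^-1.\<close>
  have "newton_system \<Omega> A z \<alpha> \<gamma> d w uk yk pk u' y' p' \<longleftrightarrow>
      R1 \<and> R2 \<and> Hm1_eq \<Omega> (app_op \<Omega> A y') (emb \<Omega> (\<lambda>x. ?H x + ?D x))"
    using assms(2,4,9-14) L2
    by (auto simp: newton_system_def R1_def R2_def Hm1_eq_def app_op_diff[OF \<Omega>] emb_diff emb_add HD)
  \<comment> \<open>\<open>R1\<close> identifies A y' with u' in H^-1, which removes the operator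
    from the third row.\<close>
  also have "\<dots> \<longleftrightarrow> R1 \<and> R2 \<and> Hm1_eq \<Omega> (emb \<Omega> u') (emb \<Omega> (\<lambda>x. ?H x + ?D x))"
    by (auto simp: R1_def Hm1_eq_def)
  \<comment> \<open>Both sides now come from L^2, where equality in H^-1 is equality almost
    everywhere.\<close>
  also have "\<dots> \<longleftrightarrow> R1 \<and> R2 \<and> ae_eq \<Omega> u' (\<lambda>x. ?H x + ?D x)"
    using emb_eq_iff[OF \<Omega> assms(12) L2_add[OF HD]] by simp
  also have "\<dots> \<longleftrightarrow> (\<exists>l'\<in>L2 \<Omega>. active_set_system \<Omega> A z \<alpha> \<gamma> d w pk u' y' p' l')"
    unfolding active_set_rows_iff[OF \<Omega>(2) assms(12) L2[OF assms(14)]]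
    by (simp add: active_set_system_def R1_def R2_def)
  finally show ?thesis .
qed

end
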